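(* Let $\{T^t\}_{t\ge 0}$ be a measure-preserving measurable semiflow on a Lebesgue space $(X,\mu)$ with $\mu(X)=1$, and let $\alpha\colon\mathbb R_+\times X\to\mathbb R$ be an additive cocycle over $\{T^t\}$, i.e. a measurable function with $\alpha(t+s,x)=\alpha(t,x)+\alpha(s,T^tx)$ for all $t,s\ge 0$ and $x\in X$. Suppose that $\alpha(t,\cdot)\in L^1(X,\mu)$ for each $t$. Then for $\mu$-almost every $x\in X$ there exists the limit in density $$\operatorname{d-lim}_{t\to\infty}\frac{\alpha(t,x)}{t}=\beta(x),$$ where the function $\beta$ is measurable, $T^t$-invariant, and $$\int_X\beta(x)\,d\mu(x)=\frac1t\int_X\alpha(t,x)\,d\mu(x)\quad\text{for every } t>0.$$ Moreover, the neglected subset of the time axis can be chosen measurably depending on $x$ and of finite Lebesgue measure for each $x$: there are sets $\tau(x)\subset\mathbb R_+$, depending measurably on $x$, with $\lambda(\tau(x))<\infty$ for each $x$, such that for $\mu$-a.e. $x$ $$\lim_{t\to\infty,\ t\notin\tau(x)}\frac{\alpha(t,x)}{t}=\beta(x).$$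
   Context: $\lambda$ denotes Lebesgue measure on $\mathbb R$, and $\mathbb R_+=[0,\infty)$. The upper density of a Borel set $\tau\subset\mathbb R_+$ is $\bar{\mathrm d}(\tau)=\limsup_{t\to\infty}\lambda(\tau\cap[0,t])/t$. A function $f(t)$ converges in density to $l$ as $t\to\infty$, written $\operatorname{d-lim}_{t\to\infty}f(t)=l$, if there is a set $\tau\subset\mathbb R_+$ of density $0$ such that $\lim_{t\to\infty,\,t\notin\tau}f(t)=l$. The semiflow is measurable in the sense that $(t,x)\mapsto T^tx$ is measurable. $T^t$-invariance of $\beta$ means $\beta\circ T^t=\beta$ for every $t\ge0$. Measurable dependence of $\tau(x)$ on $x$ means that $\{(t,x):t\in\tau(x)\}$ is a measurable subset of $\mathbb R_+\times X$. *)

theory Defs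
  imports "HOL-Probability.Probability"
begin

definition isomorphic_mod_0 :: "'a measure \<Rightarrow> 'b measure \<Rightarrow> bool" where
  "isomorphic_mod_0 M M' \<longleftrightarrow>
    (\<exists>N\<in>null_sets M. \<exists>N'\<in>null_sets M'. \<exists>f.
      bij_betw f (space M - N) (space M' - N') \<and>
      f \<in> restrict_space M (space M - N) \<rightarrow>\<^sub>M restrict_space M' (space M' - N') \<and>
      the_inv_into (space M - N) f
        \<in> restrict_space M' (space M' - N') \<rightarrow>\<^sub>M restrict_space M (space M - N) \<and>
      (\<forall>B\<in>sets M'. B \<subseteq> space M' - N' \<longrightarrow>
        emeasure M (f -` B \<inter> (space M - N)) = emeasure M' B))"

text \<open>
  A normalised Lebesgue space in the sense of Rokhlin: a complete probability space
  consisting of countably many atoms and a remainder that is isomorphic mod 0 to an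
  interval with Lebesgue measure. Either part may be missing.
\<close>

definition lebesgue_space :: "'a measure \<Rightarrow> bool" where
  "lebesgue_space M \<longleftrightarrow>
    prob_space M \<and> complete_measure M \<and>
    (\<exists>A\<subseteq>space M. countable A \<and> (\<forall>a\<in>A. {a} \<in> sets M \<and> emeasure M {a} > 0) \<and>
      isomorphic_mod_0 (restrict_space M (space M - A))
        (lebesgue_on {0..measure M (space M - A)}))"

text \<open>
  The product of the half-line and \<open>M\<close> is completed. Without completion, joint
  measurability would fail already for the rotation flow on the circle with its
  Lebesgue sigma-algebra, since the preimage of a null set that is not Borel has
  sections that are not Borel.
\<close>

definition time_product :: "'a measure \<Rightarrow> (real \<times> 'a) measure" where
  "time_product M = completion (restrict_space lborel {0..} \<Otimes>\<^sub>M M)"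

definition measure_preserving_map :: "'a measure \<Rightarrow> ('a \<Rightarrow> 'a) \<Rightarrow> bool" where
  "measure_preserving_map M S \<longleftrightarrow>
    S \<in> M \<rightarrow>\<^sub>M M \<and> (\<forall>A\<in>sets M. emeasure M (S -` A \<inter> space M) = emeasure M A)"

definition mp_semiflow :: "'a measure \<Rightarrow> (real \<Rightarrow> 'a \<Rightarrow> 'a) \<Rightarrow> bool" where
  "mp_semiflow M T \<longleftrightarrow>
    (\<forall>t\<ge>0. measure_preserving_map M (T t)) \<and>
    (\<forall>x\<in>space M. T 0 x = x) \<and>
    (\<forall>t\<ge>0. \<forall>s\<ge>0. \<forall>x\<in>space M. T (t + s) x = T t (T s x)) \<and>
    (\<lambda>(t, x). T t x) \<in> time_product M \<rightarrow>\<^sub>M M"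

definition additive_cocycle ::
    "'a measure \<Rightarrow> (real \<Rightarrow> 'a \<Rightarrow> 'a) \<Rightarrow> (real \<Rightarrow> 'a \<Rightarrow> real) \<Rightarrow> bool" where
  "additive_cocycle M T \<alpha> \<longleftrightarrow>
    (\<lambda>(t, x). \<alpha> t x) \<in> borel_measurable (time_product M) \<and>
    (\<forall>t\<ge>0. \<forall>s\<ge>0. \<forall>x\<in>space M. \<alpha> (t + s) x = \<alpha> t x + \<alpha> s (T t x))"

definition upper_density :: "real set \<Rightarrow> ereal" where
  "upper_density \<tau> = Limsup at_top (\<lambda>t. ereal (measure lborel (\<tau> \<inter> {0..t}) / t))"

definition tends_outside :: "real set \<Rightarrow> (real \<Rightarrow> real) \<Rightarrow> real \<Rightarrow> bool" where
  "tends_outside \<tau> f l \<longleftrightarrow> (f \<longlongrightarrow> l) (inf at_top (principal (- \<tau>)))"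

definition converges_in_density :: "(real \<Rightarrow> real) \<Rightarrow> real \<Rightarrow> bool" where
  "converges_in_density f l \<longleftrightarrow>
    (\<exists>\<tau>\<in>sets borel. \<tau> \<subseteq> {0..} \<and> upper_density \<tau> = 0 \<and> tends_outside \<tau> f l)"

end

theory Submission
  imports Defs
begin

text \<open>
  Along integer times the claim is Birkhoff's ergodic theorem for \<open>T 1\<close> and \<open>\<alpha> 1\<close>, proved below by
  Garsia's maximal argument. Between integers, \<open>\<alpha> (n + s) x - \<alpha> n x = \<alpha> s (T n x)\<close>. The
  function \<open>t \<mapsto> \<parallel>\<alpha> t\<parallel>\<^sub>1\<close> is measurable, finite and subadditive, hence bounded on \<open>[0, 1]\<close> by a
  Steinhaus argument, so \<open>\<alpha>\<close> is integrable on \<open>[0, 1] \<times> X\<close>. Therefore the sets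
  \<open>{(s, x). \<bar>\<alpha> s x\<bar> > c n * (n + 1)}\<close> have summable measures for a suitable sequence \<open>c n \<longrightarrow> 0\<close>, and
  since every \<open>T n\<close> preserves the measure, the times at which the increment since the preceding
  integer exceeds \<open>c n * (n + 1)\<close> form a set of finite measure for almost every \<open>x\<close>.

  Defining \<open>\<beta> x\<close> as the limit off a set of finite measure whenever it exists (and 0 otherwise)
  makes \<open>\<beta>\<close> invariant at every point, and completeness of the measure makes it measurable.
\<close>

section \<open>Birkhoff's ergodic theorem\<close>

text \<open>The constants K may depend on m; they disappear on division by n, and the slopes squeeze
  the ratio to h. Bounded partial sums, which the maximal argument supplies, lead to bounds of
  exactly this shape.\<close>

lemma LIMSEQ_from_linear_bounds:
  fixes s :: "nat \<Rightarrow> real"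
  assumes "\<And>m::nat. \<exists>K. \<forall>n. s n \<le> real n * (h + 1 / Suc m) + K"
    and "\<And>m::nat. \<exists>K. \<forall>n. - s n \<le> real n * (- h + 1 / Suc m) + K"
  shows "(\<lambda>n. s n / n) \<longlonglongrightarrow> h"
proof (rule LIMSEQ_I)
  fix r :: real assume "r > 0"
  then obtain m :: nat where m: "1 / Suc m < r / 2"
    using reals_Archimedean[of "r / 2"] by (auto simp: inverse_eq_divide)
  obtain K where K: "\<And>n. s n \<le> real n * (h + 1 / Suc m) + K" using assms(1) by blast
  obtain L where L: "\<And>n. - s n \<le> real n * (- h + 1 / Suc m) + L" using assms(2) by blast
  define C where "C = \<bar>K\<bar> + \<bar>L\<bar>"
  have "norm (s n / n - h) < r" if "n \<ge> Suc (nat \<lceil>2 * C / r\<rceil>)" for n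
  proof -
    have n: "real n > 0" "real n > 2 * C / r" using that by linarith+
    then have C: "C < real n * (r / 2)" using \<open>r > 0\<close> by (simp add: field_simps)
    have "\<bar>s n - real n * h\<bar> \<le> real n * (1 / Suc m) + C"
      using K[of n] L[of n] unfolding C_def by (simp only: distrib_left)
    also have "\<dots> < real n * (r / 2) + real n * (r / 2)"
      using C m n by (intro add_strict_mono mult_strict_left_mono) auto
    finally have "\<bar>s n - real n * h\<bar> < r * real n" by (simp add: mult.commute)
    moreover have "s n / n - h = (s n - real n * h) / n" using n by (simp add: field_simps)
    ultimately show ?thesis using n by (simp add: abs_divide pos_divide_less_eq)
  qed
  then show "\<exists>no. \<forall>n\<ge>no. norm (s n / n - h) < r" by blast
qed

section \<open>The invariant sigma-algebra of a measure-preserving map\<close>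

locale measure_preserving_system = finite_measure M
  for M :: "'a measure" +
  fixes S :: "'a \<Rightarrow> 'a"
  assumes S_measurable [measurable]: "S \<in> M \<rightarrow>\<^sub>M M"
    and distr_S: "distr M M S = M"
begin

text \<open>Invariance is strict rather than up to null sets, so that functions measurable for these
  sets are constant along every orbit.\<close>

definition invariant_sets :: "'a set set" where
  "invariant_sets = {A \<in> sets M. S -` A \<inter> space M = A}"

definition invariant_algebra :: "'a measure" where
  "invariant_algebra = sigma (space M) invariant_sets"

lemma sets_invariant_algebra: "sets invariant_algebra = invariant_sets"
proof -
  have "sigma_algebra (space M) invariant_sets"
    unfolding sigma_algebra_iff2
  proof (intro conjI ballI allI impI)
    show "invariant_sets \<subseteq> Pow (space M)"
      using sets.sets_into_space by (auto simp: invariant_sets_def)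
    show "{} \<in> invariant_sets"
      by (simp add: invariant_sets_def)
    show "space M - A \<in> invariant_sets" if A: "A \<in> invariant_sets" for A
    proof -
      have "S -` (space M - A) \<inter> space M = space M - (S -` A \<inter> space M)"
        using measurable_space[OF S_measurable] by auto
      with A show ?thesis by (auto simp: invariant_sets_def)
    qed
    show "(\<Union>i::nat. A i) \<in> invariant_sets" if A: "range A \<subseteq> invariant_sets" for A
    proof -
      have "S -` A i \<inter> space M = A i" for i using A by (auto simp: invariant_sets_def)
      then have "S -` (\<Union>i. A i) \<inter> space M = (\<Union>i. A i)" by blast
      with A show ?thesis by (auto simp: invariant_sets_def)
    qed
  qed
  then show ?thesis
    unfolding invariant_algebra_def
    by (simp add: sigma_algebra.sigma_sets_eq sigma_algebra_iff2 sets_measure_of_conv)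
qed

lemma space_invariant_algebra: "space invariant_algebra = space M"
  by (simp add: invariant_algebra_def space_measure_of_conv)

lemma subalgebra_invariant: "subalgebra M invariant_algebra"
  by (auto simp: subalgebra_def sets_invariant_algebra space_invariant_algebra invariant_sets_def)

text \<open>The level set of h through x is strictly invariant, so S x lies in it for every x, not
  just almost every x.\<close>

lemma invariant_function:
  fixes h :: "'a \<Rightarrow> real"
  assumes h: "h \<in> borel_measurable invariant_algebra" and x: "x \<in> space M"
  shows "h (S x) = h x"
proof -
  have "h -` {h x} \<inter> space M \<in> invariant_sets"
    using measurable_sets[OF h, of "{h x}"]
    by (simp add: sets_invariant_algebra space_invariant_algebra)
  with x show ?thesis by (auto simp: invariant_sets_def)
qed

lemma integral_compose_S:
  fixes f :: "'a \<Rightarrow> real"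
  assumes "integrable M f"
  shows "integrable M (\<lambda>x. f (S x))" and "(\<integral>x. f (S x) \<partial>M) = (\<integral>x. f x \<partial>M)"
proof -
  have [measurable]: "f \<in> borel_measurable M" using assms by auto
  have "integrable (distr M M S) f" using assms by (simp add: distr_S)
  then show "integrable M (\<lambda>x. f (S x))" by (subst (asm) integrable_distr_eq) auto
  show "(\<integral>x. f (S x) \<partial>M) = (\<integral>x. f x \<partial>M)"
    using integral_distr[of S M M f] by (simp add: distr_S)
qed

section \<open>Garsia's maximal inequality\<close>

text \<open>\<open>run_max g n\<close> is the maximum of the first \<open>n + 1\<close> nonempty Birkhoff sums of \<open>g\<close>.\<close>

primrec run_max :: "('a \<Rightarrow> real) \<Rightarrow> nat \<Rightarrow> 'a \<Rightarrow> real" where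
  "run_max g 0 x = g x"
| "run_max g (Suc n) x = g x + max 0 (run_max g n (S x))"

lemma run_max_mono: "run_max g n x \<le> run_max g (Suc n) x"
proof (induction n arbitrary: x)
  case (Suc n)
  have "max 0 (run_max g n (S x)) \<le> max 0 (run_max g (Suc n) (S x))"
    using Suc by (rule max.mono[OF order_refl])
  then show ?case
    by (subst (1 2) run_max.simps(2)) simp
qed simp

lemma birkhoff_sum_le_run_max: "(\<Sum>k<Suc n. g ((S ^^ k) x)) \<le> run_max g n x"
proof (induction n arbitrary: x)
  case (Suc n)
  have "(\<Sum>k<Suc (Suc n). g ((S ^^ k) x)) = g x + (\<Sum>k<Suc n. g ((S ^^ k) (S x)))"
    by (subst sum.lessThan_Suc_shift) (simp add: funpow_swap1)
  with Suc[of "S x"] show ?case by simp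
qed simp

lemma integrable_run_max:
  assumes "integrable M g" shows "integrable M (run_max g n)"
proof (induction n)
  case (Suc n)
  with assms integral_compose_S(1)[OF Suc] show ?case
    by simp
qed (use assms in simp)

text \<open>The recursion gives \<open>run_max g (Suc n) x - run_max g n (S x) = g x + max 0 (-
  run_max g n (S x))\<close>. Over the invariant set A the left side integrates to the integral of
  an increment of \<open>run_max\<close>, because S preserves the measure, and this is nonnegative.
  On A the last term on the right is eventually 0, so the limit is the integral of g.\<close>

lemma maximal_ergodic:
  fixes g :: "'a \<Rightarrow> real"
  assumes g: "integrable M g"
  defines "A \<equiv> {x \<in> space M. \<forall>K::nat. \<exists>n. run_max g n x > real K}"
  shows "A \<in> invariant_sets" and "(\<integral>x\<in>A. g x \<partial>M) \<ge> 0"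
proof -
  let ?F = "run_max g"
  note [measurable] = borel_measurable_integrable[OF integrable_run_max[OF g]]
    borel_measurable_integrable[OF g]
  have A [measurable]: "A \<in> sets M" unfolding A_def by measurable
  have up: "\<exists>n. ?F n x > real K" if x: "S x \<in> A" for x and K :: nat
  proof -
    obtain L :: nat where L: "real L \<ge> real K - g x" using real_arch_simple by blast
    obtain n where "?F n (S x) > real L" using x by (auto simp: A_def)
    with L have "?F (Suc n) x > real K" by simp
    then show ?thesis by blast
  qed
  have down: "\<exists>n. ?F n (S x) > real K" if x: "x \<in> A" for x and K :: nat
  proof -
    obtain L :: nat where L: "real L \<ge> real K + \<bar>g x\<bar>" using real_arch_simple by blast
    obtain n where "?F n x > real L" using x by (auto simp: A_def)
    then have "?F (Suc n) x > real L" using run_max_mono[of g n x] by linarith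
    with L have "?F n (S x) > real K" by (auto simp: max_def split: if_splits)
    then show ?thesis by blast
  qed
  show "A \<in> invariant_sets"
  proof -
    have "S x \<in> A \<longleftrightarrow> x \<in> A" if "x \<in> space M" for x
      using up[of x] down[of x] that measurable_space[OF S_measurable that]
      unfolding A_def mem_Collect_eq by blast
    then show ?thesis
      using A sets.sets_into_space[OF A] by (auto simp: invariant_sets_def)
  qed
  then have ind: "indicator A (S x) = (indicator A x :: real)" if "x \<in> space M" for x
    using that by (auto simp: invariant_sets_def indicator_def)
  let ?D = "\<lambda>n x. indicator A x * (g x + max 0 (- ?F n (S x)))"
  have intA: "integrable M (\<lambda>x. indicator A x * h x)" if "integrable M h" for h :: "'a \<Rightarrow> real"
    using integrable_mult_indicator[OF A that] by simp
  have nonneg: "(\<integral>x. ?D n x \<partial>M) \<ge> 0" for n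
  proof -
    note i1 = intA[OF integrable_run_max[OF g, of "Suc n"]]
    note i2 = intA[OF integrable_run_max[OF g, of n]]
    have "(\<integral>x. indicator A x * ?F n x \<partial>M) = (\<integral>x. indicator A (S x) * ?F n (S x) \<partial>M)"
      using integral_compose_S(2)[OF i2] by simp
    also have "\<dots> = (\<integral>x. indicator A x * ?F n (S x) \<partial>M)"
      by (intro Bochner_Integration.integral_cong refl) (simp add: ind)
    finally have eq: "(\<integral>x. indicator A x * ?F n x \<partial>M) = (\<integral>x. indicator A x * ?F n (S x) \<partial>M)" .
    have "(\<integral>x. indicator A x * ?F n x \<partial>M) \<le> (\<integral>x. indicator A x * ?F (Suc n) x \<partial>M)"
      using i1 i2 by (intro integral_mono mult_left_mono run_max_mono) auto
    then have "0 \<le> (\<integral>x. indicator A x * ?F (Suc n) x \<partial>M) - (\<integral>x. indicator A x * ?F n (S x) \<partial>M)"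
      using eq by simp
    also have "\<dots> = (\<integral>x. indicator A x * ?F (Suc n) x - indicator A x * ?F n (S x) \<partial>M)"
      using i1 intA[OF integral_compose_S(1)[OF integrable_run_max[OF g, of n]]]
      by (intro Bochner_Integration.integral_diff[symmetric])
    also have "\<dots> = (\<integral>x. ?D n x \<partial>M)"
      by (intro Bochner_Integration.integral_cong refl) (auto simp: indicator_def max_def)
    finally show ?thesis .
  qed
  \<comment> \<open>The maxima increase from \<open>run_max g 0 = g\<close>, so their negative part
    at S x never exceeds the absolute value of g (S x); this yields the integrable bound.\<close>
  have "(\<lambda>n. \<integral>x. ?D n x \<partial>M) \<longlonglongrightarrow> (\<integral>x. indicator A x * g x \<partial>M)"
  proof (rule integral_dominated_convergence[where w = "\<lambda>x. \<bar>g x\<bar> + \<bar>g (S x)\<bar>"])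
    show "integrable M (\<lambda>x. \<bar>g x\<bar> + \<bar>g (S x)\<bar>)"
      using g integral_compose_S(1)[OF g] by auto
    have mono: "?F n x \<ge> ?F m x" if "m \<le> n" for m n x
      using lift_Suc_mono_le[of "\<lambda>n. ?F n x" m n] run_max_mono[of g _ x] that by blast
    show "AE x in M. norm (?D n x) \<le> \<bar>g x\<bar> + \<bar>g (S x)\<bar>" for n
    proof (intro AE_I2)
      fix x
      have "\<bar>max 0 (- ?F n (S x))\<bar> \<le> \<bar>g (S x)\<bar>"
        using mono[of 0 n "S x"] by simp
      then have "\<bar>g x + max 0 (- ?F n (S x))\<bar> \<le> \<bar>g x\<bar> + \<bar>g (S x)\<bar>"
        by linarith
      then show "norm (?D n x) \<le> \<bar>g x\<bar> + \<bar>g (S x)\<bar>"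
        by (simp add: indicator_def)
    qed
    have "(\<lambda>n. ?D n x) \<longlonglongrightarrow> indicator A x * g x" for x
    proof (cases "x \<in> A")
      case True
      \<comment> \<open>Some maximum at S x is positive because the maxima are unbounded there too,
        and monotonicity keeps all later ones positive.\<close>
      then obtain n where n: "?F n (S x) > 0" using down[of x 0] by auto
      have "eventually (\<lambda>m. ?D m x = indicator A x * g x) sequentially"
        using eventually_ge_at_top[of n]
      proof eventually_elim
        case (elim m)
        with mono[of n m "S x"] n show ?case by (simp add: max_def)
      qed
      then show ?thesis by (rule tendsto_eventually)
    qed simp
    then show "AE x in M. (\<lambda>n. ?D n x) \<longlonglongrightarrow> indicator A x * g x" by simp
  qed auto
  then have "0 \<le> (\<integral>x. indicator A x * g x \<partial>M)"
    by (rule tendsto_lowerbound) (use nonneg in auto)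
  then show "(\<integral>x\<in>A. g x \<partial>M) \<ge> 0" by (simp add: set_lebesgue_integral_def)
qed

text \<open>For g = f - h - e let A be the set where the maxima of the sums of g are unbounded.
  Since f and h have equal integrals over invariant sets, g integrates over A to -e times the
  measure of A; the maximal inequality makes this nonnegative, so A is null. Off A the sums of g are
  bounded, and h is constant along the orbit.\<close>

lemma birkhoff_sum_upper_bound:
  fixes f h :: "'a \<Rightarrow> real"
  assumes f: "integrable M f" and h: "integrable M h" "h \<in> borel_measurable invariant_algebra"
    and eq: "\<And>A. A \<in> invariant_sets \<Longrightarrow> (\<integral>x\<in>A. f x \<partial>M) = (\<integral>x\<in>A. h x \<partial>M)"
    and e: "e > 0"
  shows "AE x in M. \<exists>K. \<forall>n. (\<Sum>k<n. f ((S ^^ k) x)) \<le> real n * (h x + e) + K"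
proof -
  define g where "g x = f x - (h x + e)" for x
  have g: "integrable M g" using f h unfolding g_def by simp
  define A where "A = {x \<in> space M. \<forall>K::nat. \<exists>n. run_max g n x > real K}"
  note ergodic = maximal_ergodic[OF g, folded A_def]
  have A [measurable]: "A \<in> sets M" using ergodic(1) by (simp add: invariant_sets_def)
  have intA: "set_integrable M A u" if "integrable M u" for u :: "'a \<Rightarrow> real"
    using integrable_mult_indicator[OF A that] by (simp add: set_integrable_def)
  have "0 \<le> (\<integral>x\<in>A. g x \<partial>M)" by (rule ergodic(2))
  also have "\<dots> = (\<integral>x\<in>A. f x \<partial>M) - ((\<integral>x\<in>A. h x \<partial>M) + (\<integral>x\<in>A. e \<partial>M))"
    unfolding g_def using f h
    by (subst set_integral_diff(2), auto intro!: intA, subst set_integral_add(2), auto intro!: intA)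
  also have "\<dots> = - (e * measure M A)"
    using eq[OF ergodic(1)] by (simp add: set_lebesgue_integral_def)
  finally have "measure M A = 0"
    using e by (simp add: mult_le_0_iff measure_le_0_iff)
  then have "A \<in> null_sets M"
    using A by (simp add: null_sets_def emeasure_eq_measure)
  then have "AE x in M. x \<notin> A" by (rule AE_not_in)
  then show ?thesis
    using AE_space
  proof eventually_elim
    case (elim x)
    then obtain K :: nat where K: "run_max g n x \<le> real K" for n by (auto simp: A_def not_less)
    have hk: "h ((S ^^ k) x) = h x \<and> (S ^^ k) x \<in> space M" for k
      using elim(2) invariant_function[OF h(2)] measurable_space[OF S_measurable]
      by (induction k) auto
    have "(\<Sum>k<n. f ((S ^^ k) x)) \<le> real n * (h x + e) + real K" for n
    proof (cases n)
      case (Suc m)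
      have "(\<Sum>k<n. f ((S ^^ k) x)) - real n * (h x + e) = (\<Sum>k<Suc m. g ((S ^^ k) x))"
        by (simp add: g_def hk sum_subtractf Suc algebra_simps)
      also have "\<dots> \<le> real K" using birkhoff_sum_le_run_max[where g = g and n = m and x = x] K[of m] by linarith
      finally show ?thesis by simp
    qed simp
    then show ?case by blast
  qed
qed

text \<open>The limit is the conditional expectation of f on the invariant sigma-algebra. The lower
  bound is the upper bound for -f and -h, and countably many e = 1 / (m + 1) suffice.\<close>

theorem birkhoff:
  fixes f :: "'a \<Rightarrow> real"
  assumes f: "integrable M f"
  obtains h where "integrable M h" "(\<integral>x. h x \<partial>M) = (\<integral>x. f x \<partial>M)"
    "AE x in M. (\<lambda>n. (\<Sum>k<n. f ((S ^^ k) x)) / n) \<longlonglongrightarrow> h x"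
proof
  interpret I: finite_measure_subalgebra M invariant_algebra
    by unfold_locales (rule subalgebra_invariant)
  define h where "h = real_cond_exp M invariant_algebra f"
  show h: "integrable M h" "(\<integral>x. h x \<partial>M) = (\<integral>x. f x \<partial>M)"
    unfolding h_def by (fact I.real_cond_exp_int[OF f])+
  have hI [measurable]: "h \<in> borel_measurable invariant_algebra"
    unfolding h_def by (rule borel_measurable_cond_exp)
  have eq: "(\<integral>x\<in>A. f x \<partial>M) = (\<integral>x\<in>A. h x \<partial>M)" if "A \<in> invariant_sets" for A
    unfolding h_def using f that by (intro I.real_cond_exp_intA) (simp_all add: sets_invariant_algebra)
  have "AE x in M. \<forall>m::nat. \<exists>K. \<forall>n. (\<Sum>k<n. f ((S ^^ k) x)) \<le> real n * (h x + 1 / Suc m) + K"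
    unfolding AE_all_countable
    using birkhoff_sum_upper_bound[OF f h(1) hI eq] by simp
  moreover have "AE x in M. \<forall>m::nat. \<exists>K. \<forall>n.
      (\<Sum>k<n. - f ((S ^^ k) x)) \<le> real n * (- h x + 1 / Suc m) + K"
    unfolding AE_all_countable
    using birkhoff_sum_upper_bound[of "\<lambda>x. - f x" "\<lambda>x. - h x"] f h(1) hI eq
    by (simp add: set_lebesgue_integral_def)
  ultimately show "AE x in M. (\<lambda>n. (\<Sum>k<n. f ((S ^^ k) x)) / n) \<longlonglongrightarrow> h x"
    by eventually_elim (rule LIMSEQ_from_linear_bounds, simp_all add: sum_negf)
qed

end

section \<open>Summability and real functions\<close>

lemma suminf_swap_ennreal:
  fixes f :: "nat \<Rightarrow> nat \<Rightarrow> ennreal"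
  shows "(\<Sum>n. \<Sum>k. f n k) = (\<Sum>k. \<Sum>n. f n k)"
  using nn_integral_suminf[of "\<lambda>k n. f n k" "count_space UNIV"]
  by (simp add: nn_integral_count_space_nat)

lemma suminf_tail_ennreal:
  fixes f :: "nat \<Rightarrow> ennreal" and r :: real
  assumes f: "(\<Sum>n. f n) < \<infinity>" and r: "r > 0"
  shows "\<exists>N. (\<Sum>n. if N \<le> n then f n else 0) \<le> ennreal r"
proof -
  define g where "g n = enn2real (f n)" for n
  have fg: "f n = ennreal (g n)" for n
    using ennreal_suminf_lessD[OF f] by (simp add: g_def)
  have [simp]: "g n \<ge> 0" for n by (simp add: g_def)
  have g: "summable g"
    using f by (intro summable_suminf_not_top) (auto simp: fg less_top[symmetric])
  obtain N where N: "norm (\<Sum>i. g (i + N)) < r"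
    using suminf_exist_split[OF r g] by blast
  have "(\<Sum>n. if N \<le> n then f n else 0) = (\<Sum>i. f (i + N))"
    using suminf_offset[of "\<lambda>n. if N \<le> n then f n else 0" N] by simp
  also have "\<dots> = ennreal (\<Sum>i. g (i + N))"
    unfolding fg using g by (intro suminf_ennreal2) (auto simp: summable_iff_shift)
  also have "\<dots> \<le> ennreal r" using N by (intro ennreal_leI) auto
  finally show ?thesis by blast
qed

text \<open>Let \<open>N k\<close> be an index beyond which row k contributes at most
  \<open>(1 / 2) ^ k\<close>, and let \<open>\<kappa> n\<close> be the largest k \<le> n with N k
  \<le> n. Each fixed k is admissible for all large n, so \<kappa> tends to infinity, and the
  selected entries are dominated by the sum of all the row tails.\<close>

lemma diagonal_summable:
  fixes a :: "nat \<Rightarrow> nat \<Rightarrow> ennreal"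
  assumes a: "\<And>k. (\<Sum>n. a k n) < \<infinity>"
  obtains \<kappa> :: "nat \<Rightarrow> nat" where "filterlim \<kappa> at_top sequentially" "(\<Sum>n. a (\<kappa> n) n) < \<infinity>"
proof -
  have "\<exists>N. \<forall>k. (\<Sum>n. if N k \<le> n then a k n else 0) \<le> ennreal ((1 / 2) ^ k)"
    by (intro choice allI suminf_tail_ennreal a) simp
  then obtain N' where N': "\<And>k. (\<Sum>n. if N' k \<le> n then a k n else 0) \<le> ennreal ((1 / 2) ^ k)"
    by blast
  \<comment> \<open>Setting \<open>N 0 = 0\<close> makes row 0 always admissible, so the maximum
    below exists; the price is the whole of row 0, which is finite.\<close>
  define N where "N k = (if k = 0 then 0 else N' k)" for k :: nat
  define X where "X n = {k. k \<le> n \<and> N k \<le> n}" for n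
  define \<kappa> where "\<kappa> n = Max (X n)" for n
  have X: "finite (X n)" "0 \<in> X n" for n by (auto simp: X_def N_def)
  then have \<kappa>: "\<kappa> n \<in> X n" for n unfolding \<kappa>_def by (intro Max_in) auto
  have "filterlim \<kappa> at_top sequentially"
    unfolding filterlim_at_top
  proof
    fix K
    show "\<forall>\<^sub>F n in sequentially. K \<le> \<kappa> n"
      using eventually_ge_at_top[of "max K (N K)"]
      by eventually_elim (auto simp: \<kappa>_def X_def[symmetric] intro!: Max_ge X, auto simp: X_def)
  qed
  moreover have "(\<Sum>n. a (\<kappa> n) n) < \<infinity>"
  proof -
    have "(\<Sum>n. a (\<kappa> n) n) \<le> (\<Sum>n. \<Sum>k. if N k \<le> n then a k n else 0)"
    proof (intro suminf_le summableI)
      fix n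
      have "a (\<kappa> n) n = (\<Sum>k\<in>{\<kappa> n}. if N k \<le> n then a k n else 0)"
        using \<kappa>[of n] by (simp add: X_def)
      also have "\<dots> \<le> (\<Sum>k. if N k \<le> n then a k n else 0)"
        by (intro sum_le_suminf summableI) auto
      finally show "a (\<kappa> n) n \<le> (\<Sum>k. if N k \<le> n then a k n else 0)" .
    qed
    also have "\<dots> = (\<Sum>k. \<Sum>n. if N k \<le> n then a k n else 0)"
      by (rule suminf_swap_ennreal)
    also have "\<dots> \<le> (\<Sum>k. (if k = 0 then \<Sum>n. a 0 n else 0) + ennreal ((1 / 2) ^ k))"
      using N' by (intro suminf_le summableI) (auto simp: N_def add_increasing)
    also have "\<dots> = (\<Sum>k. if k = 0 then \<Sum>n. a 0 n else 0) + (\<Sum>k. ennreal ((1 / 2) ^ k))"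
      by (intro suminf_add[symmetric] summableI)
    also have "(\<Sum>k. if k = 0 then \<Sum>n. a 0 n else 0) = (\<Sum>n. a 0 n)"
      using suminf_offset[of "\<lambda>k. if k = 0 then \<Sum>n. a 0 n else 0" 1] by simp
    also have "(\<Sum>k. ennreal ((1 / 2) ^ k)) = ennreal 2"
      by (subst suminf_ennreal2) (auto simp: suminf_geometric)
    also have "(\<Sum>n. a 0 n) + ennreal 2 < \<infinity>" using a[of 0] by simp
    finally show ?thesis .
  qed
  ultimately show thesis by (rule that)
qed

text \<open>This counts the positive integers below y. The bound by m inside the minimum is what
  carries the induction over partial sums.\<close>

lemma suminf_indicator_less:
  fixes y :: real
  assumes "y \<ge> 0"
  shows "(\<Sum>n. if real (Suc n) < y then 1 else 0 :: ennreal) \<le> ennreal y"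
proof (rule suminf_le_const[OF summableI])
  fix m
  have "(\<Sum>n<m. if real (Suc n) < y then 1 else 0 :: real) \<le> min (real m) y"
    by (induction m) (use assms in auto)
  then have "ennreal (\<Sum>n<m. if real (Suc n) < y then 1 else 0) \<le> ennreal y"
    by (intro ennreal_leI) simp
  also have "ennreal (\<Sum>n<m. if real (Suc n) < y then 1 else 0) =
      (\<Sum>n<m. if real (Suc n) < y then 1 else 0)"
    by (subst sum_ennreal[symmetric]) (auto intro!: sum.cong simp del: sum_ennreal)
  finally show "(\<Sum>n<m. if real (Suc n) < y then 1 else 0 :: ennreal) \<le> ennreal y" .
qed

text \<open>For a fixed constant 1 / (k + 1) in place of \<open>c n\<close>, counting the integers
  below (k + 1) times the absolute value of F bounds the sum of the measures by k + 1 times the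
  integral. The diagonal choice then lets k grow slowly with n.\<close>

lemma vanishing_thresholds:
  fixes F :: "'a \<Rightarrow> real"
  assumes [measurable]: "F \<in> borel_measurable Q"
    and fin: "(\<integral>\<^sup>+x. ennreal \<bar>F x\<bar> \<partial>Q) < \<infinity>"
  obtains c :: "nat \<Rightarrow> real" where "\<And>n. c n \<ge> 0" "c \<longlonglongrightarrow> 0"
    "(\<Sum>n. emeasure Q {x \<in> space Q. \<bar>F x\<bar> > c n * Suc n}) < \<infinity>"
proof -
  define a where "a k n = emeasure Q {x \<in> space Q. \<bar>F x\<bar> > (1 / Suc k) * Suc n}" for k n :: nat
  have "(\<Sum>n. a k n) < \<infinity>" for k
  proof -
    have "(\<Sum>n. a k n) = (\<Sum>n. \<integral>\<^sup>+x. (if real (Suc n) < Suc k * \<bar>F x\<bar> then 1 else 0) \<partial>Q)"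
      unfolding a_def
    proof (intro suminf_cong)
      fix n
      have "emeasure Q {x \<in> space Q. \<bar>F x\<bar> > (1 / Suc k) * Suc n} =
          (\<integral>\<^sup>+x. indicator {x \<in> space Q. \<bar>F x\<bar> > (1 / Suc k) * Suc n} x \<partial>Q)"
        by simp
      also have "\<dots> = (\<integral>\<^sup>+x. (if real (Suc n) < Suc k * \<bar>F x\<bar> then 1 else 0) \<partial>Q)"
        by (intro nn_integral_cong) (auto simp: indicator_def field_simps)
      finally show "emeasure Q {x \<in> space Q. \<bar>F x\<bar> > (1 / Suc k) * Suc n} =
          (\<integral>\<^sup>+x. (if real (Suc n) < Suc k * \<bar>F x\<bar> then 1 else 0) \<partial>Q)" .
    qed
    also have "\<dots> = (\<integral>\<^sup>+x. (\<Sum>n. if real (Suc n) < Suc k * \<bar>F x\<bar> then 1 else 0) \<partial>Q)"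
      by (intro nn_integral_suminf[symmetric]) measurable
    also have "\<dots> \<le> (\<integral>\<^sup>+x. ennreal (Suc k * \<bar>F x\<bar>) \<partial>Q)"
      by (intro nn_integral_mono suminf_indicator_less) simp
    also have "\<dots> = ennreal (Suc k) * (\<integral>\<^sup>+x. ennreal \<bar>F x\<bar> \<partial>Q)"
      by (subst nn_integral_cmult[symmetric]) (auto simp: ennreal_mult simp del: of_nat_Suc)
    also have "\<dots> < \<infinity>" using fin by (simp add: ennreal_mult_less_top)
    finally show ?thesis .
  qed
  then obtain \<kappa> where \<kappa>: "filterlim \<kappa> at_top sequentially" "(\<Sum>n. a (\<kappa> n) n) < \<infinity>"
    by (rule diagonal_summable)
  show thesis
  proof (rule that[of "\<lambda>n. 1 / Suc (\<kappa> n)"])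
    show "(\<lambda>n. 1 / Suc (\<kappa> n)) \<longlonglongrightarrow> 0"
      using LIMSEQ_inverse_real_of_nat \<kappa>(1) unfolding inverse_eq_divide by (rule filterlim_compose)
  qed (use \<kappa>(2) in \<open>auto simp: a_def\<close>)
qed

section \<open>Steinhaus' argument and Cauchy's functional equation\<close>

text \<open>A quantitative Steinhaus lemma: \<open>E\<close> and \<open>E - t\<close> are too large to be disjoint
  subsets of \<open>[- 1 / 2, 1]\<close>.\<close>

lemma large_set_difference:
  fixes E :: "real set"
  assumes E: "E \<in> sets lborel" "E \<subseteq> {0..1}" "emeasure lborel E > ennreal (3 / 4)"
    and t: "0 \<le> t" "t \<le> 1 / 2"
  shows "\<exists>e\<in>E. e + t \<in> E"
proof (rule ccontr)
  assume contra: "\<not> ?thesis"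
  let ?E' = "(+) t -` E \<inter> space lborel"
  have E' [measurable]: "?E' \<in> sets lborel"
    using E(1) by (intro measurable_sets[of _ lborel borel]) auto
  have "emeasure lborel ?E' = emeasure (distr lborel borel ((+) t)) E"
    using E(1) by (subst emeasure_distr) auto
  then have eq: "emeasure lborel ?E' = emeasure lborel E" by (simp add: lborel_distr_plus)
  have "ennreal (3 / 2) = ennreal (3 / 4) + ennreal (3 / 4)"
    by (subst ennreal_plus[symmetric]) auto
  also have "\<dots> < emeasure lborel E + emeasure lborel ?E'"
    unfolding eq by (intro add_strict_mono E)
  also have "\<dots> = emeasure lborel (E \<union> ?E')"
    using E(1) E' contra by (intro plus_emeasure) (auto simp: add.commute)
  also have "\<dots> \<le> emeasure lborel {- 1 / 2..1::real}"
    using E(2) t by (intro emeasure_mono) fastforce+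
  also have "\<dots> = ennreal (3 / 2)" by simp
  finally show False by simp
qed

text \<open>Write n t = m + r with m an integer and r in [0, 1]. Additivity turns n (a t - t a 1)
  into a r - r a 1, which is bounded independently of n; hence a t - t a 1 = 0.\<close>

lemma additive_bounded_linear:
  fixes a :: "real \<Rightarrow> real"
  assumes add: "\<And>s t. s \<ge> 0 \<Longrightarrow> t \<ge> 0 \<Longrightarrow> a (s + t) = a s + a t"
    and bound: "\<And>t. 0 \<le> t \<Longrightarrow> t \<le> 1 \<Longrightarrow> \<bar>a t\<bar> \<le> K" and t: "t \<ge> 0"
  shows "a t = t * a 1"
proof -
  have nat: "a (real n * s) = real n * a s" if "s \<ge> 0" for n s
  proof (induction n)
    case 0
    show ?case using add[of 0 0] by simp
  next
    case (Suc n)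
    then show ?case using add[of s "real n * s"] that by (simp add: algebra_simps)
  qed
  have "real n * \<bar>a t - t * a 1\<bar> \<le> K + \<bar>a 1\<bar>" for n
  proof -
    define m where "m = nat \<lfloor>real n * t\<rfloor>"
    define r where "r = real n * t - real m"
    have "0 \<le> real n * t" using t by simp
    then have r: "0 \<le> r" "r \<le> 1" unfolding r_def m_def by linarith+
    have "real n * a t = a (real m * 1 + r)" using nat[OF t, of n] by (simp add: r_def)
    also have "\<dots> = real m * a 1 + a r"
      using add[of "real m" r] nat[of 1 m] r by simp
    finally have "real n * (a t - t * a 1) = a r - r * a 1"
      by (simp add: r_def algebra_simps)
    moreover have "\<bar>r * a 1\<bar> \<le> 1 * \<bar>a 1\<bar>"
      unfolding abs_mult using r by (intro mult_right_mono) auto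
    ultimately have "\<bar>real n * (a t - t * a 1)\<bar> \<le> K + \<bar>a 1\<bar>"
      using bound[OF r] by linarith
    then show ?thesis by (simp add: abs_mult)
  qed
  then have "\<bar>a t - t * a 1\<bar> = 0"
    using reals_Archimedean3[of "\<bar>a t - t * a 1\<bar>"] by (metis abs_ge_zero less_le not_less)
  then show ?thesis by simp
qed

lemma complete_measure_borel_measurable_AE:
  fixes f g :: "'a \<Rightarrow> real"
  assumes "complete_measure M" and f [measurable]: "f \<in> borel_measurable M"
    and eq: "AE x in M. f x = g x"
  shows "g \<in> borel_measurable M"
proof (rule measurableI)
  fix A :: "real set" assume [measurable]: "A \<in> sets borel"
  show "g -` A \<inter> space M \<in> sets M"
  proof (rule complete_measure.in_sets_AE[OF assms(1)])
    show "AE x in M. x \<in> f -` A \<inter> space M \<longleftrightarrow> x \<in> g -` A \<inter> space M"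
      using eq by eventually_elim auto
  qed auto
qed simp

lemma emeasure_translate:
  fixes \<tau> :: "real set"
  assumes "\<tau> \<in> sets borel"
  shows "(+) a -` \<tau> \<in> sets borel" "emeasure lborel ((+) a -` \<tau>) = emeasure lborel \<tau>"
proof -
  show "(+) a -` \<tau> \<in> sets borel"
    using measurable_sets[of "(+) a" borel borel \<tau>] assms by simp
  have "emeasure (distr lborel borel ((+) a)) \<tau> = emeasure lborel ((+) a -` \<tau>)"
    using assms by (subst emeasure_distr) auto
  then show "emeasure lborel ((+) a -` \<tau>) = emeasure lborel \<tau>"
    by (simp add: lborel_distr_plus)
qed

section \<open>Limits off sets of finite measure\<close>

text \<open>Finite measure survives unions, which gives uniqueness of the limit, and translations,
  which gives invariance under the semiflow. The sets may reach below 0 so that translates stay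
  admissible.\<close>

definition limit_off_finite :: "(real \<Rightarrow> real) \<Rightarrow> real \<Rightarrow> bool" where
  "limit_off_finite f l \<longleftrightarrow>
    (\<exists>\<tau>\<in>sets borel. emeasure lborel \<tau> < \<infinity> \<and> tends_outside \<tau> f l)"

lemma tends_outside_mono:
  assumes "tends_outside \<tau> f l" "\<tau> \<subseteq> \<tau>'"
  shows "tends_outside \<tau>' f l"
  using assms unfolding tends_outside_def
  by (elim filterlim_mono[OF _ order_refl]) (intro inf_mono order_refl, simp)

lemma emeasure_lborel_at_least: "emeasure lborel {a::real..} = \<infinity>"
proof -
  have "ennreal (real n) \<le> emeasure lborel {a..}" for n
    using emeasure_mono[of "{a..a + real n}" "{a..}" lborel] by simp
  then show ?thesis
    by (metis ennreal_Ex_less_of_nat ennreal_of_nat_eq_real_of_nat infinity_ennreal_def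
        leD less_top)
qed

text \<open>The union of two exceptional sets has finite measure and so contains no ray. Hence
  arbitrarily late times lie outside both, and the filter off the union is nontrivial.\<close>

lemma limit_off_finite_unique:
  assumes "limit_off_finite f l" "limit_off_finite f l'"
  shows "l = l'"
proof -
  obtain \<tau> \<tau>' where \<tau>: "\<tau> \<in> sets borel" "emeasure lborel \<tau> < \<infinity>" "tends_outside \<tau> f l"
    and \<tau>': "\<tau>' \<in> sets borel" "emeasure lborel \<tau>' < \<infinity>" "tends_outside \<tau>' f l'"
    using assms unfolding limit_off_finite_def by blast
  let ?F = "inf at_top (principal (- (\<tau> \<union> \<tau>')))"
  have "?F \<noteq> bot"
  proof
    assume "?F = bot"
    then have "\<forall>\<^sub>F t in at_top. t \<in> \<tau> \<union> \<tau>'"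
      using eventually_inf_principal[of "\<lambda>_. False" at_top "- (\<tau> \<union> \<tau>')"] by simp
    then obtain N where "{N..} \<subseteq> \<tau> \<union> \<tau>'"
      unfolding eventually_at_top_linorder by auto
    then have "emeasure lborel {N..} \<le> emeasure lborel (\<tau> \<union> \<tau>')"
      using \<tau>(1) \<tau>'(1) by (intro emeasure_mono) auto
    also have "\<dots> \<le> emeasure lborel \<tau> + emeasure lborel \<tau>'"
      using \<tau>(1) \<tau>'(1) by (intro emeasure_subadditive) auto
    also have "\<dots> < \<infinity>" using \<tau>(2) \<tau>'(2) by simp
    finally show False by (simp add: emeasure_lborel_at_least)
  qed
  moreover have "(f \<longlongrightarrow> l) ?F" "(f \<longlongrightarrow> l') ?F"
    using tends_outside_mono[OF \<tau>(3), of "\<tau> \<union> \<tau>'"] tends_outside_mono[OF \<tau>'(3), of "\<tau> \<union> \<tau>'"]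
    by (auto simp: tends_outside_def)
  ultimately show ?thesis by (rule tendsto_unique)
qed

text \<open>The exceptional set is translated by -a. Passing from the denominator a + s to s costs
  the factor a / s + 1, which tends to 1, and c / s tends to 0. The shift a may be negative, which
  is why g is controlled only eventually.\<close>

lemma limit_off_finite_shift:
  assumes lim: "limit_off_finite (\<lambda>s. f s / s) l"
    and g: "\<forall>\<^sub>F s in at_top. g s = f (a + s) + c"
  shows "limit_off_finite (\<lambda>s. g s / s) l"
proof -
  obtain \<tau> where \<tau>: "\<tau> \<in> sets borel" "emeasure lborel \<tau> < \<infinity>"
    "tends_outside \<tau> (\<lambda>s. f s / s) l"
    using lim unfolding limit_off_finite_def by blast
  let ?G = "inf at_top (principal (- ((+) a -` \<tau>)))"
  have shift: "filterlim ((+) a) at_top at_top"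
    by (rule filterlim_tendsto_add_at_top[OF tendsto_const filterlim_ident])
  have "filterlim ((+) a) (inf at_top (principal (- \<tau>))) ?G"
    unfolding filterlim_inf filterlim_principal
    using filterlim_mono[OF shift order_refl inf_le1]
    by (auto simp: eventually_inf_principal)
  with \<tau>(3) have lim_f: "((\<lambda>s. f (a + s) / (a + s)) \<longlongrightarrow> l) ?G"
    unfolding tends_outside_def by (rule filterlim_compose)
  have zero: "((\<lambda>s. b / s) \<longlongrightarrow> 0) ?G" for b :: real
    by (rule filterlim_mono[OF _ order_refl inf_le1])
      (intro tendsto_divide_0[OF tendsto_const] filterlim_at_top_imp_at_infinity filterlim_ident)
  have "((\<lambda>s. (f (a + s) / (a + s)) * (a / s + 1) + c / s) \<longlongrightarrow> l * (0 + 1) + 0) ?G"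
    by (intro tendsto_add tendsto_mult lim_f zero tendsto_const)
  then have "((\<lambda>s. (f (a + s) / (a + s)) * (a / s + 1) + c / s) \<longlongrightarrow> l) ?G"
    by simp
  moreover have "\<forall>\<^sub>F s in ?G. (f (a + s) / (a + s)) * (a / s + 1) + c / s = g s / s"
  proof (rule filter_leD[OF inf_le1])
    show "\<forall>\<^sub>F s in at_top. (f (a + s) / (a + s)) * (a / s + 1) + c / s = g s / s"
      using g eventually_gt_at_top[of 0] eventually_gt_at_top[of "- a"]
    proof eventually_elim
      case (elim s)
      then have "(f (a + s) / (a + s)) * (a / s + 1) = f (a + s) / s"
        by (simp add: divide_simps)
      with elim show ?case by (simp add: add_divide_distrib)
    qed
  qed
  ultimately have "tends_outside ((+) a -` \<tau>) (\<lambda>s. g s / s) l"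
    unfolding tends_outside_def by (rule Lim_transform_eventually)
  then show ?thesis
    using \<tau>(1,2) emeasure_translate[OF \<tau>(1), of a] unfolding limit_off_finite_def by metis
qed

lemma converges_in_density_if_finite_exception:
  assumes \<tau>: "\<tau> \<in> sets borel" "\<tau> \<subseteq> {0..}" "emeasure lborel \<tau> < \<infinity>" "tends_outside \<tau> f l"
  shows "converges_in_density f l"
proof -
  have "((\<lambda>t. measure lborel (\<tau> \<inter> {0..t}) / t) \<longlongrightarrow> 0) at_top"
  proof (rule tendsto_sandwich)
    show "\<forall>\<^sub>F t in at_top. 0 \<le> measure lborel (\<tau> \<inter> {0..t}) / t"
      using eventually_gt_at_top[of 0] by eventually_elim simp
    show "\<forall>\<^sub>F t in at_top. measure lborel (\<tau> \<inter> {0..t}) / t \<le> measure lborel \<tau> / t"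
      using eventually_gt_at_top[of 0]
      by eventually_elim
        (use \<tau> in \<open>auto intro!: divide_right_mono measure_mono_fmeasurable simp: fmeasurable_def\<close>)
    show "((\<lambda>t. measure lborel \<tau> / t) \<longlongrightarrow> 0) at_top"
      by (intro tendsto_divide_0[OF tendsto_const] filterlim_at_top_imp_at_infinity filterlim_ident)
  qed simp
  then have "((\<lambda>t. ereal (measure lborel (\<tau> \<inter> {0..t}) / t)) \<longlongrightarrow> ereal 0) at_top"
    by (rule tendsto_ereal)
  then have "upper_density \<tau> = 0"
    unfolding upper_density_def zero_ereal_def by (intro lim_imp_Limsup) auto
  with \<tau> show ?thesis unfolding converges_in_density_def by blast
qed

section \<open>Interpolation between integer times\<close>

lemma filterlim_nat_floor: "filterlim (\<lambda>t::real. nat \<lfloor>t\<rfloor>) at_top at_top"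
  unfolding filterlim_at_top
proof
  fix Z :: nat
  show "\<forall>\<^sub>F t::real in at_top. Z \<le> nat \<lfloor>t\<rfloor>"
    using eventually_ge_at_top[of "real Z"] by eventually_elim (rule le_nat_floor)
qed

lemma tendsto_floor_ratio: "((\<lambda>t::real. real (nat \<lfloor>t\<rfloor>) / t) \<longlongrightarrow> 1) at_top"
proof (rule tendsto_sandwich)
  have "((\<lambda>t::real. 1 - 1 / t) \<longlongrightarrow> 1 - 0) at_top"
    by (intro tendsto_diff tendsto_const tendsto_divide_0[OF tendsto_const]
        filterlim_at_top_imp_at_infinity filterlim_ident)
  then show "((\<lambda>t::real. 1 - 1 / t) \<longlongrightarrow> 1) at_top" by simp
  show "\<forall>\<^sub>F t::real in at_top. 1 - 1 / t \<le> real (nat \<lfloor>t\<rfloor>) / t"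
    using eventually_gt_at_top[of 0]
  proof eventually_elim
    case (elim t)
    have "1 - 1 / t = (t - 1) / t" using elim by (simp add: field_simps)
    also have "\<dots> \<le> real (nat \<lfloor>t\<rfloor>) / t" using elim by (intro divide_right_mono) linarith+
    finally show ?case .
  qed
  show "\<forall>\<^sub>F t::real in at_top. real (nat \<lfloor>t\<rfloor>) / t \<le> 1"
    using eventually_gt_at_top[of 0] by eventually_elim (simp add: divide_le_eq)
qed simp

text \<open>With k the integer part of t, f t / t is (f k / k) (k / t) plus (f t - f k) / t. The
  first term tends to l along all times, the second to 0 off the exceptional set.\<close>

lemma tends_outside_interpolate:
  fixes f :: "real \<Rightarrow> real" and c :: "nat \<Rightarrow> real"
  assumes nat: "(\<lambda>n. f (real n) / n) \<longlonglongrightarrow> l" and c: "c \<longlonglongrightarrow> 0"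
    and f: "\<And>t. t \<ge> 0 \<Longrightarrow> t \<notin> \<tau> \<Longrightarrow>
      \<bar>f t - f (real (nat \<lfloor>t\<rfloor>))\<bar> \<le> c (nat \<lfloor>t\<rfloor>) * Suc (nat \<lfloor>t\<rfloor>)"
  shows "tends_outside \<tau> (\<lambda>t. f t / t) l"
proof -
  let ?k = "\<lambda>t::real. nat \<lfloor>t\<rfloor>" and ?F = "inf at_top (principal (- \<tau>))"
  have "((\<lambda>t. (f (real (?k t)) / ?k t) * (?k t / t)) \<longlongrightarrow> l * 1) at_top"
    by (intro tendsto_mult tendsto_floor_ratio filterlim_compose[OF nat filterlim_nat_floor])
  then have main: "((\<lambda>t. (f (real (?k t)) / ?k t) * (?k t / t)) \<longlongrightarrow> l * 1) ?F"
    by (rule filterlim_mono[OF _ order_refl inf_le1])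
  have "((\<lambda>t. \<bar>c (?k t)\<bar> * 2) \<longlongrightarrow> \<bar>0\<bar> * 2) at_top"
    by (intro tendsto_mult tendsto_rabs tendsto_const filterlim_compose[OF c filterlim_nat_floor])
  then have small: "((\<lambda>t. \<bar>c (?k t)\<bar> * 2) \<longlongrightarrow> 0) ?F"
    by (intro filterlim_mono[OF _ order_refl inf_le1]) simp
  have "\<forall>\<^sub>F t in ?F. norm ((f t - f (real (?k t))) / t) \<le> \<bar>c (?k t)\<bar> * 2"
    unfolding eventually_inf_principal using eventually_ge_at_top[of 1]
  proof eventually_elim
    case (elim t)
    show ?case
    proof
      assume "t \<in> - \<tau>"
      then have "\<bar>f t - f (real (?k t))\<bar> \<le> c (?k t) * Suc (?k t)" using elim by (intro f) auto
      \<comment> \<open>For t \<ge> 1 one has k + 1 \<le> t + 1 \<le> 2 t, the source of the factor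
        2.\<close>
      also have "\<dots> \<le> \<bar>c (?k t)\<bar> * (2 * t)" using elim by (intro mult_mono) linarith+
      finally show "norm ((f t - f (real (?k t))) / t) \<le> \<bar>c (?k t)\<bar> * 2"
        using elim by (simp add: abs_divide divide_le_eq mult.assoc)
    qed
  qed
  from Lim_null_comparison[OF this small]
  have "((\<lambda>t. (f (real (?k t)) / ?k t) * (?k t / t) + (f t - f (real (?k t))) / t) \<longlongrightarrow> l * 1 + 0) ?F"
    by (intro tendsto_add main)
  moreover have "\<forall>\<^sub>F t in ?F. (f (real (?k t)) / ?k t) * (?k t / t) + (f t - f (real (?k t))) / t = f t / t"
  proof (rule filter_leD[OF inf_le1])
    show "\<forall>\<^sub>F t in at_top. (f (real (?k t)) / ?k t) * (?k t / t) + (f t - f (real (?k t))) / t = f t / t"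
      using eventually_ge_at_top[of 1]
    proof eventually_elim
      case (elim t)
      then have "real (?k t) \<noteq> 0" by linarith
      with elim show ?case by (simp add: diff_divide_distrib)
    qed
  qed
  ultimately show ?thesis
    unfolding tends_outside_def by (simp add: Lim_transform_eventually)
qed

section \<open>Integrable cocycles\<close>

locale integrable_cocycle = prob_space M + complete_measure M
  for M :: "'a measure" +
  fixes T :: "real \<Rightarrow> 'a \<Rightarrow> 'a" and \<alpha> :: "real \<Rightarrow> 'a \<Rightarrow> real"
  assumes semiflow: "mp_semiflow M T"
    and cocycle: "additive_cocycle M T \<alpha>"
    and integrable_\<alpha>: "\<And>t. t \<ge> 0 \<Longrightarrow> integrable M (\<alpha> t)"
begin

lemma measurable_T: "t \<ge> 0 \<Longrightarrow> T t \<in> M \<rightarrow>\<^sub>M M"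
  using semiflow by (auto simp: mp_semiflow_def measure_preserving_map_def)

lemma measurable_\<alpha>: "t \<ge> 0 \<Longrightarrow> \<alpha> t \<in> borel_measurable M"
  using integrable_\<alpha> by blast

lemma space_T: "t \<ge> 0 \<Longrightarrow> x \<in> space M \<Longrightarrow> T t x \<in> space M"
  using measurable_T measurable_space by metis

lemma distr_T:
  assumes "t \<ge> 0" shows "distr M M (T t) = M"
  using semiflow assms measurable_T[OF assms]
  by (intro measure_eqI) (auto simp: mp_semiflow_def measure_preserving_map_def emeasure_distr)

lemma cocycle_add:
  "t \<ge> 0 \<Longrightarrow> s \<ge> 0 \<Longrightarrow> x \<in> space M \<Longrightarrow> \<alpha> (t + s) x = \<alpha> t x + \<alpha> s (T t x)"
  using cocycle by (auto simp: additive_cocycle_def)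

lemma mps_T: "t \<ge> 0 \<Longrightarrow> measure_preserving_system M (T t)"
  by unfold_locales (auto intro: measurable_T distr_T)

lemma T_funpow:
  assumes "x \<in> space M" shows "(T 1 ^^ k) x = T (real k) x"
proof (induction k)
  case 0
  show ?case using semiflow assms by (simp add: mp_semiflow_def)
next
  case (Suc k)
  have "T (1 + real k) x = T 1 (T (real k) x)"
    using semiflow assms unfolding mp_semiflow_def by (meson of_nat_0_le_iff zero_le_one)
  with Suc show ?case by simp
qed

lemma cocycle_birkhoff_sum:
  assumes x: "x \<in> space M" shows "\<alpha> (real n) x = (\<Sum>k<n. \<alpha> 1 ((T 1 ^^ k) x))"
proof (induction n)
  case 0
  have "\<alpha> (0 + 0) x = \<alpha> 0 x + \<alpha> 0 (T 0 x)" using x by (intro cocycle_add) auto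
  then show ?case using semiflow x by (simp add: mp_semiflow_def)
next
  case (Suc n)
  have "\<alpha> (real n + 1) x = \<alpha> (real n) x + \<alpha> 1 (T (real n) x)"
    using x by (intro cocycle_add) auto
  with Suc show ?case by (simp add: T_funpow[OF x] add.commute)
qed

section \<open>The product of the time half-line with the phase space\<close>

definition half_line :: "real measure" where
  "half_line = restrict_space lborel {0..}"

lemma space_half_line [simp]: "space half_line = {0..}"
  by (simp add: half_line_def space_restrict_space)

lemma sets_half_line_iff: "A \<in> sets half_line \<longleftrightarrow> A \<subseteq> {0..} \<and> A \<in> sets borel"
  unfolding half_line_def by (subst sets_restrict_space_iff) auto

lemma emeasure_half_line: "A \<subseteq> {0..} \<Longrightarrow> emeasure half_line A = emeasure lborel A"
  unfolding half_line_def by (intro emeasure_restrict_space) auto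

lemma AE_half_line: "(AE t in half_line. P t) \<longleftrightarrow> (AE t in lborel. t \<ge> 0 \<longrightarrow> P t)"
  unfolding half_line_def by (subst AE_restrict_space_iff) auto

lemma nn_integral_half_line:
  "(\<integral>\<^sup>+t. f t \<partial>half_line) = (\<integral>\<^sup>+t. f t * indicator {0..} t \<partial>lborel)"
  unfolding half_line_def by (rule nn_integral_restrict_space) auto

lemma measurable_half_line: "f \<in> borel \<rightarrow>\<^sub>M N \<Longrightarrow> f \<in> half_line \<rightarrow>\<^sub>M N"
  unfolding half_line_def by (rule measurable_restrict_space1) simp

lemma pair_sigma_finite_half_line: "pair_sigma_finite half_line M"
proof -
  interpret L: sigma_finite_measure half_line
    unfolding half_line_def
    by (intro sigma_finite_measure_restrict_space sigma_finite_lborel) auto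
  show ?thesis ..
qed

lemma time_product_eq: "time_product M = completion (half_line \<Otimes>\<^sub>M M)"
  by (simp add: time_product_def half_line_def)

section \<open>Norms and means of the cocycle\<close>

text \<open>All three follow from the cocycle identity, since composing with \<open>T s\<close>
  changes neither norm nor mean. The second is the triangle inequality solved for
  \<open>\<alpha> t\<close>: two times of small norm control their difference, as Steinhaus'
  argument requires.\<close>

lemma norm_\<alpha>_add:
  assumes "s \<ge> 0" "t \<ge> 0"
  shows "(\<integral>x. \<bar>\<alpha> (s + t) x\<bar> \<partial>M) \<le> (\<integral>x. \<bar>\<alpha> s x\<bar> \<partial>M) + (\<integral>x. \<bar>\<alpha> t x\<bar> \<partial>M)"
    and "(\<integral>x. \<bar>\<alpha> t x\<bar> \<partial>M) \<le> (\<integral>x. \<bar>\<alpha> (s + t) x\<bar> \<partial>M) + (\<integral>x. \<bar>\<alpha> s x\<bar> \<partial>M)"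
    and "(\<integral>x. \<alpha> (s + t) x \<partial>M) = (\<integral>x. \<alpha> s x \<partial>M) + (\<integral>x. \<alpha> t x \<partial>M)"
proof -
  interpret S: measure_preserving_system M "T s" using assms by (intro mps_T)
  note int = integrable_\<alpha>[OF assms(1)] integrable_\<alpha>[OF assms(2)] integrable_\<alpha>[of "s + t"]
  note abs = S.integral_compose_S[OF integrable_abs[OF integrable_\<alpha>[OF assms(2)]]]
  note comp = S.integral_compose_S[OF integrable_\<alpha>[OF assms(2)]]
  have add: "\<alpha> (s + t) x = \<alpha> s x + \<alpha> t (T s x)" if "x \<in> space M" for x
    using assms that by (rule cocycle_add)
  have "(\<integral>x. \<bar>\<alpha> (s + t) x\<bar> \<partial>M) \<le> (\<integral>x. \<bar>\<alpha> s x\<bar> + \<bar>\<alpha> t (T s x)\<bar> \<partial>M)"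
    using int abs assms by (intro integral_mono) (auto simp: add)
  also have "\<dots> = (\<integral>x. \<bar>\<alpha> s x\<bar> \<partial>M) + (\<integral>x. \<bar>\<alpha> t x\<bar> \<partial>M)"
    using int abs by (subst Bochner_Integration.integral_add) auto
  finally show "(\<integral>x. \<bar>\<alpha> (s + t) x\<bar> \<partial>M) \<le> (\<integral>x. \<bar>\<alpha> s x\<bar> \<partial>M) + (\<integral>x. \<bar>\<alpha> t x\<bar> \<partial>M)" .
  have "(\<integral>x. \<bar>\<alpha> t (T s x)\<bar> \<partial>M) \<le> (\<integral>x. \<bar>\<alpha> (s + t) x\<bar> + \<bar>\<alpha> s x\<bar> \<partial>M)"
    using int abs assms by (intro integral_mono) (auto simp: add)
  also have "\<dots> = (\<integral>x. \<bar>\<alpha> (s + t) x\<bar> \<partial>M) + (\<integral>x. \<bar>\<alpha> s x\<bar> \<partial>M)"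
    using int assms by (subst Bochner_Integration.integral_add) auto
  finally show "(\<integral>x. \<bar>\<alpha> t x\<bar> \<partial>M) \<le> (\<integral>x. \<bar>\<alpha> (s + t) x\<bar> \<partial>M) + (\<integral>x. \<bar>\<alpha> s x\<bar> \<partial>M)"
    using abs by simp
  have "(\<integral>x. \<alpha> (s + t) x \<partial>M) = (\<integral>x. \<alpha> s x + \<alpha> t (T s x) \<partial>M)"
    by (intro Bochner_Integration.integral_cong refl add)
  also have "\<dots> = (\<integral>x. \<alpha> s x \<partial>M) + (\<integral>x. \<alpha> t x \<partial>M)"
    using int comp by (subst Bochner_Integration.integral_add) auto
  finally show "(\<integral>x. \<alpha> (s + t) x \<partial>M) = (\<integral>x. \<alpha> s x \<partial>M) + (\<integral>x. \<alpha> t x \<partial>M)" .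
qed

text \<open>The cocycle is measurable only for the completed product; \<open>\<alpha>'\<close> is a version of it
  that is measurable for the product itself.\<close>

lemma measurable_version:
  obtains \<alpha>' :: "real \<times> 'a \<Rightarrow> real" where "\<alpha>' \<in> borel_measurable (half_line \<Otimes>\<^sub>M M)"
    "AE z in half_line \<Otimes>\<^sub>M M. case_prod \<alpha> z = \<alpha>' z"
    "AE t in lborel. t \<ge> 0 \<longrightarrow> (AE x in M. \<alpha> t x = \<alpha>' (t, x))"
proof -
  interpret P: pair_sigma_finite half_line M by (rule pair_sigma_finite_half_line)
  have "case_prod \<alpha> \<in> borel_measurable (completion (half_line \<Otimes>\<^sub>M M))"
    using cocycle by (simp add: additive_cocycle_def time_product_eq)
  from completion_ex_borel_measurable_real[OF this]
  obtain \<alpha>' where \<alpha>': "\<alpha>' \<in> borel_measurable (half_line \<Otimes>\<^sub>M M)"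
    "AE z in half_line \<Otimes>\<^sub>M M. case_prod \<alpha> z = \<alpha>' z" by blast
  from P.AE_pair[OF \<alpha>'(2)]
  have "AE t in lborel. t \<ge> 0 \<longrightarrow> (AE x in M. \<alpha> t x = \<alpha>' (t, x))"
    unfolding AE_half_line by simp
  with \<alpha>' show thesis by (rule that)
qed

text \<open>The sets of times in [0, 1] with norm at most C exhaust [0, 1] up to a null set, so for
  some C one of them has measure above 3 / 4. Every t \<le> 1 / 2 is then a difference of two of its
  points, and doubling reaches t \<le> 1.\<close>

lemma norm_\<alpha>_bounded:
  obtains K where "\<And>t. 0 \<le> t \<Longrightarrow> t \<le> 1 \<Longrightarrow> (\<integral>x. \<bar>\<alpha> t x\<bar> \<partial>M) \<le> K"
proof -
  interpret P: pair_sigma_finite half_line M by (rule pair_sigma_finite_half_line)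
  obtain \<alpha>' where \<alpha>' [measurable]: "\<alpha>' \<in> borel_measurable (half_line \<Otimes>\<^sub>M M)"
    and "AE t in lborel. t \<ge> 0 \<longrightarrow> (AE x in M. \<alpha> t x = \<alpha>' (t, x))"
    using measurable_version by blast
  then have "AE t in half_line. AE x in M. \<alpha> t x = \<alpha>' (t, x)"
    by (simp add: AE_half_line)
  then obtain N where N: "N \<in> null_sets half_line"
    "\<And>t. t \<ge> 0 \<Longrightarrow> t \<notin> N \<Longrightarrow> AE x in M. \<alpha> t x = \<alpha>' (t, x)"
    by (erule_tac AE_E3) auto
  define \<phi> where "\<phi> t = (\<integral>\<^sup>+x. ennreal \<bar>\<alpha>' (t, x)\<bar> \<partial>M)" for t
  have [measurable]: "\<phi> \<in> borel_measurable half_line" unfolding \<phi>_def by measurable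
  have \<phi>: "\<phi> t = ennreal (\<integral>x. \<bar>\<alpha> t x\<bar> \<partial>M)" if "t \<ge> 0" "t \<notin> N" for t
  proof -
    have "\<phi> t = (\<integral>\<^sup>+x. ennreal \<bar>\<alpha> t x\<bar> \<partial>M)"
      unfolding \<phi>_def using N(2)[OF that] by (intro nn_integral_cong_AE) auto
    also have "\<dots> = ennreal (\<integral>x. \<bar>\<alpha> t x\<bar> \<partial>M)"
      using integrable_\<alpha>[OF that(1)] by (intro nn_integral_eq_integral) auto
    finally show ?thesis .
  qed
  \<comment> \<open>Times in N are removed because only off N does the measurable function \<phi>
    give the norm of the cocycle.\<close>
  define E where "E C = {t \<in> space half_line. t \<le> 1 \<and> \<phi> t \<le> ennreal (real C)} - N" for C :: nat
  have E [measurable]: "E C \<in> sets half_line" for C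
  proof -
    have [measurable]: "N \<in> sets half_line" using N(1) by auto
    have [measurable]: "(\<lambda>t. t) \<in> borel_measurable half_line" by (rule measurable_half_line) simp
    show ?thesis unfolding E_def by measurable
  qed
  have "incseq E"
    by (auto simp: incseq_def E_def intro: order_trans ennreal_leI)
  then have "(\<lambda>C. emeasure half_line (E C)) \<longlonglongrightarrow> emeasure half_line (\<Union>C. E C)"
    using E by (intro Lim_emeasure_incseq) auto
  moreover have "(\<Union>C. E C) = {0..1} - N"
  proof -
    have "\<exists>C::nat. \<phi> t \<le> ennreal (real C)" if "t \<ge> 0" "t \<notin> N" for t
      unfolding \<phi>[OF that] using real_arch_simple by (blast intro: ennreal_leI)
    then show ?thesis by (auto simp: E_def)
  qed
  moreover have "emeasure half_line ({0..1} - N) = 1"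
    using N(1) by (subst emeasure_Diff_null_set) (auto simp: sets_half_line_iff emeasure_half_line)
  ultimately have "(\<lambda>C. emeasure half_line (E C)) \<longlonglongrightarrow> 1" by simp
  moreover have "ennreal (3 / 4) < 1" by (simp add: ennreal_less_one_iff)
  ultimately have "\<forall>\<^sub>F C in sequentially. ennreal (3 / 4) < emeasure half_line (E C)"
    by (rule order_tendstoD(1))
  then obtain C where C: "ennreal (3 / 4) < emeasure half_line (E C)"
    unfolding eventually_sequentially by blast
  have sub: "E C \<subseteq> {0..1}" by (auto simp: E_def)
  have EC: "E C \<in> sets lborel" "ennreal (3 / 4) < emeasure lborel (E C)"
    using E[of C] C emeasure_half_line[of "E C"] sub by (auto simp: sets_half_line_iff)
  let ?n = "\<lambda>t. \<integral>x. \<bar>\<alpha> t x\<bar> \<partial>M"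
  have small: "?n t \<le> real C" if "t \<in> E C" for t
    using that \<phi>[of t] by (auto simp: E_def)
  have half: "?n t \<le> 2 * real C" if t: "0 \<le> t" "t \<le> 1 / 2" for t
  proof -
    obtain e where e: "e \<in> E C" "e + t \<in> E C"
      using large_set_difference[OF EC(1) sub EC(2) t] by blast
    then have "e \<ge> 0" using sub by auto
    from norm_\<alpha>_add(2)[OF this t(1)] small[OF e(1)] small[OF e(2)] show ?thesis by simp
  qed
  have "?n t \<le> 4 * real C" if t: "0 \<le> t" "t \<le> 1" for t
    using norm_\<alpha>_add(1)[of "t / 2" "t / 2"] half[of "t / 2"] t by simp
  then show thesis by (rule that)
qed

text \<open>The mean is additive in t and bounded on [0, 1] by the norm, so Cauchy's equation leaves
  only linear functions.\<close>

lemma integral_\<alpha>_linear: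
  assumes "t \<ge> 0" shows "(\<integral>x. \<alpha> t x \<partial>M) = t * (\<integral>x. \<alpha> 1 x \<partial>M)"
proof -
  obtain K where K: "\<And>t. 0 \<le> t \<Longrightarrow> t \<le> 1 \<Longrightarrow> (\<integral>x. \<bar>\<alpha> t x\<bar> \<partial>M) \<le> K"
    using norm_\<alpha>_bounded by blast
  show ?thesis
  proof (rule additive_bounded_linear[where a = "\<lambda>t. \<integral>x. \<alpha> t x \<partial>M" and K = K])
    show "\<bar>\<integral>x. \<alpha> t x \<partial>M\<bar> \<le> K" if "0 \<le> t" "t \<le> 1" for t
      using integral_abs_bound[of M "\<alpha> t"] K[OF that] by linarith
  qed (use assms norm_\<alpha>_add(3) in auto)
qed

section \<open>The set of exceptional times\<close>

text \<open>The increment is \<open>\<alpha> t\<close> composed with \<open>T s\<close>, hence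
  distributed as \<open>\<alpha> t\<close>. Every unit time interval is thereby reduced to [0,
  1).\<close>

lemma emeasure_cocycle_increment:
  assumes "s \<ge> 0" "t \<ge> 0"
  shows "emeasure M {x \<in> space M. \<bar>\<alpha> (s + t) x - \<alpha> s x\<bar> > r} = emeasure M {x \<in> space M. \<bar>\<alpha> t x\<bar> > r}"
proof -
  note [measurable] = measurable_\<alpha>[OF assms(2)] measurable_T[OF assms(1)]
  have "emeasure M {x \<in> space M. \<bar>\<alpha> t x\<bar> > r} = emeasure (distr M M (T s)) {x \<in> space M. \<bar>\<alpha> t x\<bar> > r}"
    using assms by (simp add: distr_T)
  also have "\<dots> = emeasure M (T s -` {x \<in> space M. \<bar>\<alpha> t x\<bar> > r} \<inter> space M)"
    by (rule emeasure_distr) measurable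
  also have "T s -` {x \<in> space M. \<bar>\<alpha> t x\<bar> > r} \<inter> space M = {x \<in> space M. \<bar>\<alpha> (s + t) x - \<alpha> s x\<bar> > r}"
    using assms by (auto simp: cocycle_add space_T)
  finally show ?thesis ..
qed

text \<open>The exceptional set collects the times at which the increment of the cocycle since the
  preceding integer exceeds \<open>c n * (n + 1)\<close>; the null set on which \<open>\<alpha>\<close> and its version
  \<open>\<alpha>'\<close> differ is thrown in, which makes all sections Borel.\<close>

lemma exceptional_set:
  obtains B and c :: "nat \<Rightarrow> real" where "c \<longlonglongrightarrow> 0" "B \<in> sets (half_line \<Otimes>\<^sub>M M)"
    "emeasure (half_line \<Otimes>\<^sub>M M) B < \<infinity>"
    "\<And>t x. t \<ge> 0 \<Longrightarrow> x \<in> space M \<Longrightarrow> (t, x) \<notin> B \<Longrightarrow>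
      \<bar>\<alpha> t x - \<alpha> (real (nat \<lfloor>t\<rfloor>)) x\<bar> \<le> c (nat \<lfloor>t\<rfloor>) * Suc (nat \<lfloor>t\<rfloor>)"
proof -
  interpret P: pair_sigma_finite half_line M by (rule pair_sigma_finite_half_line)
  let ?P = "half_line \<Otimes>\<^sub>M M"
  obtain \<alpha>' where \<alpha>' [measurable]: "\<alpha>' \<in> borel_measurable ?P"
    and ae: "AE z in ?P. case_prod \<alpha> z = \<alpha>' z"
    and ae': "AE t in lborel. t \<ge> 0 \<longrightarrow> (AE x in M. \<alpha> t x = \<alpha>' (t, x))"
    by (rule measurable_version)
  obtain K where K: "\<And>t. 0 \<le> t \<Longrightarrow> t \<le> 1 \<Longrightarrow> (\<integral>x. \<bar>\<alpha> t x\<bar> \<partial>M) \<le> K"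
    using norm_\<alpha>_bounded by blast
  have [measurable]: "(\<lambda>t. t) \<in> borel_measurable half_line" by (rule measurable_half_line) simp
  define F where "F z = (if fst z < 1 then \<alpha>' z else 0)" for z :: "real \<times> 'a"
  have F [measurable]: "F \<in> borel_measurable ?P" unfolding F_def by measurable
  have "(\<integral>\<^sup>+z. ennreal \<bar>F z\<bar> \<partial>?P) = (\<integral>\<^sup>+t. \<integral>\<^sup>+x. ennreal \<bar>F (t, x)\<bar> \<partial>M \<partial>half_line)"
    by (rule nn_integral_fst[symmetric]) measurable
  also have "\<dots> \<le> (\<integral>\<^sup>+t. ennreal K * indicator {0..1} t \<partial>half_line)"
  proof (rule nn_integral_mono_AE)
    show "AE t in half_line. (\<integral>\<^sup>+x. ennreal \<bar>F (t, x)\<bar> \<partial>M) \<le> ennreal K * indicator {0..1} t"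
      unfolding AE_half_line using ae'
    proof eventually_elim
      case (elim t)
      show ?case
      proof
        assume t: "t \<ge> 0"
        show "(\<integral>\<^sup>+x. ennreal \<bar>F (t, x)\<bar> \<partial>M) \<le> ennreal K * indicator {0..1} t"
        proof (cases "t < 1")
          case True
          have "(\<integral>\<^sup>+x. ennreal \<bar>F (t, x)\<bar> \<partial>M) = (\<integral>\<^sup>+x. ennreal \<bar>\<alpha> t x\<bar> \<partial>M)"
            using elim t True by (intro nn_integral_cong_AE) (auto simp: F_def)
          also have "\<dots> = ennreal (\<integral>x. \<bar>\<alpha> t x\<bar> \<partial>M)"
            using integrable_\<alpha>[OF t] by (intro nn_integral_eq_integral) auto
          also have "\<dots> \<le> ennreal K" using K[OF t] True by (intro ennreal_leI) simp
          finally show ?thesis using t True by simp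
        qed (simp add: F_def)
      qed
    qed
  qed
  also have "\<dots> = ennreal K * emeasure half_line {0..1}"
    by (rule nn_integral_cmult_indicator) (simp add: sets_half_line_iff)
  also have "\<dots> < \<infinity>" by (simp add: emeasure_half_line)
  finally have fin: "(\<integral>\<^sup>+z. ennreal \<bar>F z\<bar> \<partial>?P) < \<infinity>" .
  obtain c :: "nat \<Rightarrow> real" where c: "\<And>n. c n \<ge> 0" "c \<longlonglongrightarrow> 0"
    "(\<Sum>n. emeasure ?P {z \<in> space ?P. \<bar>F z\<bar> > c n * Suc n}) < \<infinity>"
    by (rule vanishing_thresholds[OF F fin]) (rule that)
  define H where "H n t = emeasure M {x \<in> space M. \<bar>\<alpha>' (t, x)\<bar> > c n * Suc n} * indicator {0..<1} t"
    for n :: nat and t :: real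
  have H [measurable]: "H n \<in> borel_measurable borel" for n
  proof -
    \<comment> \<open>Multiplication by the indicator of the half-line extends measurability to the
      whole line, where the translations below act.\<close>
    have "H n = (\<lambda>t. (if t < 1 then emeasure M {x \<in> space M. \<bar>\<alpha>' (t, x)\<bar> > c n * Suc n} else 0) * indicator {0..} t)"
      by (auto simp: H_def indicator_def fun_eq_iff)
    moreover have "(\<lambda>t. if t < 1 then emeasure M {x \<in> space M. \<bar>\<alpha>' (t, x)\<bar> > c n * Suc n} else 0)
        \<in> borel_measurable (restrict_space lborel {0..})"
      unfolding half_line_def[symmetric] by measurable
    then have "(\<lambda>t. (if t < 1 then emeasure M {x \<in> space M. \<bar>\<alpha>' (t, x)\<bar> > c n * Suc n} else 0) * indicator {0..} t)
        \<in> borel_measurable lborel"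
      by (subst (asm) borel_measurable_restrict_space_iff_ennreal) auto
    ultimately show ?thesis by simp
  qed
  have sum_H: "(\<Sum>n. \<integral>\<^sup>+t. H n t \<partial>lborel) < \<infinity>"
  proof -
    have "(\<integral>\<^sup>+t. H n t \<partial>lborel) = emeasure ?P {z \<in> space ?P. \<bar>F z\<bar> > c n * Suc n}" for n
    proof -
      have "emeasure ?P {z \<in> space ?P. \<bar>F z\<bar> > c n * Suc n} =
          (\<integral>\<^sup>+t. emeasure M (Pair t -` {z \<in> space ?P. \<bar>F z\<bar> > c n * Suc n}) \<partial>half_line)"
        by (rule emeasure_pair_measure_alt) measurable
      also have "\<dots> = (\<integral>\<^sup>+t. H n t \<partial>half_line)"
      proof (rule nn_integral_cong)
        fix t assume "t \<in> space half_line"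
        \<comment> \<open>Nonnegative thresholds and the strict inequality exclude the times t \<ge>
          1, where F was set to 0.\<close>
        then have "Pair t -` {z \<in> space ?P. \<bar>F z\<bar> > c n * Suc n} =
            (if t < 1 then {x \<in> space M. \<bar>\<alpha>' (t, x)\<bar> > c n * Suc n} else {})"
          using c(1)[of n] by (auto simp: F_def space_pair_measure not_less mult_nonneg_nonneg)
        with \<open>t \<in> space half_line\<close>
        show "emeasure M (Pair t -` {z \<in> space ?P. \<bar>F z\<bar> > c n * Suc n}) = H n t"
          by (simp add: H_def)
      qed
      also have "\<dots> = (\<integral>\<^sup>+t. H n t \<partial>lborel)"
        unfolding nn_integral_half_line
        by (intro nn_integral_cong) (auto simp: H_def indicator_def)
      finally show ?thesis ..
    qed
    with c(3) show ?thesis by simp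
  qed
  define k where "k t = nat \<lfloor>t\<rfloor>" for t :: real
  \<comment> \<open>At integer times \<alpha> itself is used: the integers form a null set of times,
    so \<alpha>' need not agree with \<alpha> there. Measurability persists because only countably
    many functions \<open>\<alpha> (real n)\<close> occur.\<close>
  define G where "G z = \<bar>\<alpha>' z - \<alpha> (real (k (fst z))) (snd z)\<bar>" for z
  define B' where "B' = {z \<in> space ?P. G z > c (k (fst z)) * Suc (k (fst z))}"
  have k [measurable]: "(\<lambda>z. k (fst z)) \<in> ?P \<rightarrow>\<^sub>M count_space UNIV"
    unfolding k_def by (rule measurable_compose[OF measurable_fst measurable_half_line]) measurable
  have [measurable]: "(\<lambda>z. c (k (fst z)) * Suc (k (fst z))) \<in> borel_measurable ?P"
    by (rule measurable_compose[OF k]) simp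
  have [measurable]: "(\<lambda>z. \<alpha> (real (k (fst z))) (snd z)) \<in> borel_measurable ?P"
    by (rule measurable_compose_countable[where f = "\<lambda>n z. \<alpha> (real n) (snd z)"])
      (auto intro!: measurable_compose[OF measurable_snd] measurable_\<alpha>)
  have B' [measurable]: "B' \<in> sets ?P" unfolding B'_def G_def by measurable
  have "emeasure ?P B' = (\<integral>\<^sup>+t. emeasure M (Pair t -` B') \<partial>half_line)"
    by (rule emeasure_pair_measure_alt) measurable
  also have "\<dots> \<le> (\<integral>\<^sup>+t. (\<Sum>n. H n (- real n + t)) \<partial>half_line)"
  proof (rule nn_integral_mono_AE)
    \<comment> \<open>The bad times of the version and their translates by all integers n form one
      null set, so almost every t allows replacing \<alpha> by \<alpha>' at t and at t - n
      simultaneously.\<close>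
    have "AE t in lborel. \<forall>n. - real n + t \<ge> 0 \<longrightarrow> (AE x in M. \<alpha> (- real n + t) x = \<alpha>' (- real n + t, x))"
      unfolding AE_all_countable
    proof
      fix n :: nat
      have "AE t in distr lborel borel ((+) (- real n)). t \<ge> 0 \<longrightarrow> (AE x in M. \<alpha> t x = \<alpha>' (t, x))"
        using ae' by (simp only: lborel_distr_plus)
      from AE_distrD[OF _ this]
      show "AE t in lborel. - real n + t \<ge> 0 \<longrightarrow> (AE x in M. \<alpha> (- real n + t) x = \<alpha>' (- real n + t, x))"
        by simp
    qed
    with ae' show "AE t in half_line. emeasure M (Pair t -` B') \<le> (\<Sum>n. H n (- real n + t))"
      unfolding AE_half_line
    proof eventually_elim
      case (elim t)
      show ?case
      proof
        assume t: "t \<ge> 0"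
        define n where "n = k t"
        define s where "s = - real n + t"
        have s: "0 \<le> s" "s < 1" and ts: "t = real n + s"
          using t unfolding s_def n_def k_def by linarith+
        have e1: "AE x in M. \<alpha> t x = \<alpha>' (t, x)" using elim(1) t by simp
        have e2: "AE x in M. \<alpha> s x = \<alpha>' (s, x)" using elim(2) s(1) unfolding s_def by blast
        have \<alpha>t [measurable]: "\<alpha> t \<in> borel_measurable M" "\<alpha> s \<in> borel_measurable M"
          "\<alpha> (real n) \<in> borel_measurable M"
          using t s by (auto intro: measurable_\<alpha>)
        have sec [measurable]: "(\<lambda>x. \<alpha>' (s, x)) \<in> borel_measurable M"
          using s by (intro measurable_Pair2[OF \<alpha>']) simp
        have "emeasure M (Pair t -` B') = emeasure M {x \<in> space M. \<bar>\<alpha> (real n + s) x - \<alpha> (real n) x\<bar> > c n * Suc n}"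
        proof (rule emeasure_eq_AE)
          show "AE x in M. x \<in> Pair t -` B' \<longleftrightarrow> x \<in> {x \<in> space M. \<bar>\<alpha> (real n + s) x - \<alpha> (real n) x\<bar> > c n * Suc n}"
            using e1 by eventually_elim
              (use t in \<open>auto simp: B'_def G_def space_pair_measure n_def[symmetric] ts[symmetric]\<close>)
          show "Pair t -` B' \<in> sets M" by (rule sets_Pair1[OF B'])
        qed (unfold ts[symmetric], measurable)
        also have "\<dots> = emeasure M {x \<in> space M. \<bar>\<alpha> s x\<bar> > c n * Suc n}"
          using s by (intro emeasure_cocycle_increment) auto
        also have "\<dots> = emeasure M {x \<in> space M. \<bar>\<alpha>' (s, x)\<bar> > c n * Suc n}"
          using e2 by (intro emeasure_eq_AE) (auto elim!: eventually_mono)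
        also have "\<dots> = H n (- real n + t)"
          unfolding H_def s_def[symmetric] using s by simp
        \<comment> \<open>The single term belonging to the integer part of t is enlarged to the full
          series, so that sum and integral can be exchanged over all unit intervals at once.\<close>
        also have "\<dots> = (\<Sum>m\<in>{n}. H m (- real m + t))" by simp
        also have "\<dots> \<le> (\<Sum>m. H m (- real m + t))"
          by (intro sum_le_suminf summableI) auto
        finally show "emeasure M (Pair t -` B') \<le> (\<Sum>n. H n (- real n + t))" .
      qed
    qed
  qed
  also have "\<dots> \<le> (\<integral>\<^sup>+t. (\<Sum>n. H n (- real n + t)) \<partial>lborel)"
    unfolding nn_integral_half_line by (intro nn_integral_mono) (auto simp: indicator_def)
  also have "\<dots> = (\<Sum>n. \<integral>\<^sup>+t. H n (- real n + t) \<partial>lborel)"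
    by (rule nn_integral_suminf, rule measurable_compose[OF _ H]) simp
  also have "\<dots> = (\<Sum>n. \<integral>\<^sup>+t. H n t \<partial>lborel)"
  proof (rule suminf_cong)
    fix n
    show "(\<integral>\<^sup>+t. H n (- real n + t) \<partial>lborel) = (\<integral>\<^sup>+t. H n t \<partial>lborel)"
      using nn_integral_real_affine[OF H, of 1 n "- real n"] by simp
  qed
  also note sum_H
  finally have B'_fin: "emeasure ?P B' < \<infinity>" .
  obtain N where N: "\<And>z. z \<in> space ?P - N \<Longrightarrow> case_prod \<alpha> z = \<alpha>' z" "N \<in> null_sets ?P"
    by (rule AE_E3[OF ae]) (rule that)
  show thesis
  proof (rule that[OF c(2), of "B' \<union> N"])
    show "B' \<union> N \<in> sets ?P" using N(2) by auto
    show "emeasure ?P (B' \<union> N) < \<infinity>"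
      using B'_fin emeasure_Un_null_set[OF B' N(2)] by simp
    fix t x assume tx: "t \<ge> 0" "x \<in> space M" "(t, x) \<notin> B' \<union> N"
    then have "\<alpha> t x = \<alpha>' (t, x)" using N(1)[of "(t, x)"] by (simp add: space_pair_measure)
    with tx show "\<bar>\<alpha> t x - \<alpha> (real (nat \<lfloor>t\<rfloor>)) x\<bar> \<le> c (nat \<lfloor>t\<rfloor>) * Suc (nat \<lfloor>t\<rfloor>)"
      by (simp add: B'_def G_def k_def space_pair_measure not_less)
  qed
qed

text \<open>By Fubini, almost every section of the exceptional set has finite measure. Birkhoff's
  theorem gives the limit along integers, and interpolation extends it to all times off the
  section.\<close>

lemma finite_exceptional_sections:
  obtains \<tau> h where
    "{(t, x). x \<in> space M \<and> t \<in> \<tau> x} \<in> sets (time_product M)"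
    "\<And>x. x \<in> space M \<Longrightarrow> \<tau> x \<subseteq> {0..} \<and> \<tau> x \<in> sets borel \<and> emeasure lborel (\<tau> x) < \<infinity>"
    "AE x in M. tends_outside (\<tau> x) (\<lambda>t. \<alpha> t x / t) (h x)"
    "integrable M h" "(\<integral>x. h x \<partial>M) = (\<integral>x. \<alpha> 1 x \<partial>M)"
proof -
  interpret P: pair_sigma_finite half_line M by (rule pair_sigma_finite_half_line)
  interpret S: measure_preserving_system M "T 1" by (rule mps_T) simp
  let ?P = "half_line \<Otimes>\<^sub>M M"
  have "integrable M (\<alpha> 1)" by (rule integrable_\<alpha>) simp
  then obtain h where h: "integrable M h" "(\<integral>x. h x \<partial>M) = (\<integral>x. \<alpha> 1 x \<partial>M)"
    "AE x in M. (\<lambda>n. (\<Sum>k<n. \<alpha> 1 ((T 1 ^^ k) x)) / n) \<longlonglongrightarrow> h x"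
    by (rule S.birkhoff)
  obtain B and c :: "nat \<Rightarrow> real" where c: "c \<longlonglongrightarrow> 0"
    and B [measurable]: "B \<in> sets ?P" and fin: "emeasure ?P B < \<infinity>"
    and bound: "\<And>t x. t \<ge> 0 \<Longrightarrow> x \<in> space M \<Longrightarrow> (t, x) \<notin> B \<Longrightarrow>
      \<bar>\<alpha> t x - \<alpha> (real (nat \<lfloor>t\<rfloor>)) x\<bar> \<le> c (nat \<lfloor>t\<rfloor>) * Suc (nat \<lfloor>t\<rfloor>)"
    by (rule exceptional_set) (rule that)
  define sec where "sec x = (\<lambda>t. (t, x)) -` B" for x
  have sec: "sec x \<in> sets half_line" for x unfolding sec_def by (rule sets_Pair2[OF B])
  have [measurable]: "(\<lambda>x. emeasure half_line (sec x)) \<in> borel_measurable M"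
    unfolding sec_def by (rule P.measurable_emeasure_Pair2[OF B])
  define G where "G = {x \<in> space M. emeasure half_line (sec x) \<noteq> \<infinity>}"
  have [measurable]: "G \<in> sets M" unfolding G_def by measurable
  have "(\<integral>\<^sup>+x. emeasure half_line (sec x) \<partial>M) \<noteq> \<infinity>"
    using fin unfolding sec_def P.emeasure_pair_measure_alt2[OF B, symmetric] by simp
  then have AE_G: "AE x in M. x \<in> G"
    using nn_integral_PInf_AE[of "\<lambda>x. emeasure half_line (sec x)" M] by (auto simp: G_def)
  \<comment> \<open>Sections of infinite measure are replaced by the empty set, so finiteness holds
    for every x; this alters \<tau> on a null set of points only.\<close>
  define \<tau> where "\<tau> x = (if x \<in> G then sec x else {})" for x
  show thesis
  proof (rule that[of \<tau> h, OF _ _ _ h(1,2)])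
    have "{(t, x). x \<in> space M \<and> t \<in> \<tau> x} = B \<inter> (space half_line \<times> G)"
      using sets.sets_into_space[OF B] sets.sets_into_space[of G M]
      by (auto simp: \<tau>_def sec_def G_def space_pair_measure split: if_splits)
    also have "\<dots> \<in> sets ?P" by measurable
    finally show "{(t, x). x \<in> space M \<and> t \<in> \<tau> x} \<in> sets (time_product M)"
      unfolding time_product_eq by (rule sets_completionI_sets)
    show "\<tau> x \<subseteq> {0..} \<and> \<tau> x \<in> sets borel \<and> emeasure lborel (\<tau> x) < \<infinity>" if "x \<in> space M" for x
      using sec[of x] emeasure_half_line[of "sec x"]
      by (auto simp: \<tau>_def G_def sets_half_line_iff less_top)
    show "AE x in M. tends_outside (\<tau> x) (\<lambda>t. \<alpha> t x / t) (h x)"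
      using h(3) AE_G AE_space
    proof eventually_elim
      case (elim x)
      show ?case
      proof (rule tends_outside_interpolate[OF _ c])
        show "(\<lambda>n. \<alpha> (real n) x / n) \<longlonglongrightarrow> h x"
          using elim by (simp add: cocycle_birkhoff_sum)
        show "\<bar>\<alpha> t x - \<alpha> (real (nat \<lfloor>t\<rfloor>)) x\<bar> \<le> c (nat \<lfloor>t\<rfloor>) * Suc (nat \<lfloor>t\<rfloor>)"
          if "t \<ge> 0" "t \<notin> \<tau> x" for t
          using that elim by (intro bound) (auto simp: \<tau>_def sec_def)
      qed
    qed
  qed
qed

section \<open>Invariance of the limit\<close>

text \<open>The trajectories of the cocycle from x and from \<open>T t x\<close> differ by a time
  shift and an additive constant. Shifting time by -t or by t gives the two directions, with no need
  to invert \<open>T t\<close>.\<close>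

lemma limit_off_finite_T_iff:
  assumes t: "t \<ge> 0" and x: "x \<in> space M"
  shows "limit_off_finite (\<lambda>s. \<alpha> s (T t x) / s) l \<longleftrightarrow> limit_off_finite (\<lambda>s. \<alpha> s x / s) l"
proof
  have "\<forall>\<^sub>F s in at_top. \<alpha> s x = \<alpha> (- t + s) (T t x) + \<alpha> t x"
    using eventually_ge_at_top[of t]
  proof eventually_elim
    case (elim s)
    with cocycle_add[OF t _ x, of "- t + s"] show ?case by simp
  qed
  then show "limit_off_finite (\<lambda>s. \<alpha> s x / s) l" if "limit_off_finite (\<lambda>s. \<alpha> s (T t x) / s) l"
    using limit_off_finite_shift[where g = "\<lambda>s. \<alpha> s x", OF that] by blast
  have "\<forall>\<^sub>F s in at_top. \<alpha> s (T t x) = \<alpha> (t + s) x + (- \<alpha> t x)"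
    using eventually_ge_at_top[of 0]
  proof eventually_elim
    case (elim s)
    with cocycle_add[OF t _ x, of s] show ?case by simp
  qed
  then show "limit_off_finite (\<lambda>s. \<alpha> s (T t x) / s) l" if "limit_off_finite (\<lambda>s. \<alpha> s x / s) l"
    using limit_off_finite_shift[where g = "\<lambda>s. \<alpha> s (T t x)", OF that] by blast
qed

end

theorem theorem1:
  fixes M :: "'a measure"
    and T :: "real \<Rightarrow> 'a \<Rightarrow> 'a"
    and \<alpha> :: "real \<Rightarrow> 'a \<Rightarrow> real"
  assumes "lebesgue_space M"
    and "mp_semiflow M T"
    and "additive_cocycle M T \<alpha>"
    and "\<And>t. t \<ge> 0 \<Longrightarrow> integrable M (\<alpha> t)"
  shows "\<exists>\<beta>.
    (AE x in M. converges_in_density (\<lambda>t. \<alpha> t x / t) (\<beta> x)) \<and>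
    \<beta> \<in> borel_measurable M \<and>
    (\<forall>t\<ge>0. \<forall>x\<in>space M. \<beta> (T t x) = \<beta> x) \<and>
    integrable M \<beta> \<and>
    (\<forall>t>0. (\<integral>x. \<beta> x \<partial>M) = (1 / t) * (\<integral>x. \<alpha> t x \<partial>M)) \<and>
    (\<exists>\<tau> :: 'a \<Rightarrow> real set.
      {(t, x). x \<in> space M \<and> t \<in> \<tau> x} \<in> sets (time_product M) \<and>
      (\<forall>x\<in>space M. \<tau> x \<subseteq> {0..} \<and> \<tau> x \<in> sets borel \<and> emeasure lborel (\<tau> x) < \<infinity>) \<and>
      (AE x in M. tends_outside (\<tau> x) (\<lambda>t. \<alpha> t x / t) (\<beta> x)))"
proof -
  have "prob_space M" "complete_measure M"
    using assms(1) by (auto simp: lebesgue_space_def)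
  then interpret integrable_cocycle M T \<alpha>
    using assms(2-4) by (simp add: integrable_cocycle_def integrable_cocycle_axioms_def)
  obtain \<tau> h where \<tau>: "{(t, x). x \<in> space M \<and> t \<in> \<tau> x} \<in> sets (time_product M)"
    "\<And>x. x \<in> space M \<Longrightarrow> \<tau> x \<subseteq> {0..} \<and> \<tau> x \<in> sets borel \<and> emeasure lborel (\<tau> x) < \<infinity>"
    and lim: "AE x in M. tends_outside (\<tau> x) (\<lambda>t. \<alpha> t x / t) (h x)"
    and h: "integrable M h" "(\<integral>x. h x \<partial>M) = (\<integral>x. \<alpha> 1 x \<partial>M)"
    by (rule finite_exceptional_sections) (rule that)
  \<comment> \<open>The function h comes from the time-one map and carries no invariance under the
    other \<open>T t\<close>, so the limit is redefined intrinsically from \<alpha>, without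
    reference to \<tau> or h.\<close>
  define \<beta> where "\<beta> x = (if \<exists>l. limit_off_finite (\<lambda>t. \<alpha> t x / t) l
    then THE l. limit_off_finite (\<lambda>t. \<alpha> t x / t) l else 0)" for x
  have \<beta>_eq: "\<beta> x = l" if "limit_off_finite (\<lambda>t. \<alpha> t x / t) l" for x l
    using that limit_off_finite_unique unfolding \<beta>_def by (auto intro!: the_equality)
  have h_\<beta>: "AE x in M. h x = \<beta> x"
    using lim AE_space
  proof eventually_elim
    case (elim x)
    then have "limit_off_finite (\<lambda>t. \<alpha> t x / t) (h x)"
      using \<tau>(2)[of x] unfolding limit_off_finite_def by blast
    then show ?case by (rule \<beta>_eq[symmetric])
  qed
  have [measurable]: "h \<in> borel_measurable M" using h(1) by blast
  have \<beta> [measurable]: "\<beta> \<in> borel_measurable M"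
    using \<open>complete_measure M\<close> _ h_\<beta> by (rule complete_measure_borel_measurable_AE) measurable
  have lim_\<beta>: "AE x in M. tends_outside (\<tau> x) (\<lambda>t. \<alpha> t x / t) (\<beta> x)"
    using lim h_\<beta> by eventually_elim simp
  have "AE x in M. converges_in_density (\<lambda>t. \<alpha> t x / t) (\<beta> x)"
    using lim_\<beta> AE_space
  proof eventually_elim
    case (elim x)
    with \<tau>(2)[of x] show ?case by (blast intro: converges_in_density_if_finite_exception)
  qed
  moreover have "\<beta> (T t x) = \<beta> x" if "t \<ge> 0" "x \<in> space M" for t x
  proof -
    \<comment> \<open>The two predicates in l coincide, so existence of a limit, its value and the
      default 0 all agree at x and \<open>T t x\<close>.\<close>
    have "limit_off_finite (\<lambda>s. \<alpha> s (T t x) / s) = limit_off_finite (\<lambda>s. \<alpha> s x / s)"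
      using that by (simp add: fun_eq_iff limit_off_finite_T_iff)
    then show ?thesis by (simp add: \<beta>_def)
  qed
  moreover have "integrable M \<beta>"
    using h(1) integrable_cong_AE[OF _ \<beta> h_\<beta>] by simp
  moreover have "(\<integral>x. \<beta> x \<partial>M) = (1 / t) * (\<integral>x. \<alpha> t x \<partial>M)" if "t > 0" for t
  proof -
    have "(\<integral>x. \<beta> x \<partial>M) = (\<integral>x. \<alpha> 1 x \<partial>M)"
      using h(2) integral_cong_AE[OF _ \<beta> h_\<beta>] by simp
    with that integral_\<alpha>_linear[of t] show ?thesis by simp
  qed
  ultimately show ?thesis
    using \<beta> \<tau> lim_\<beta> by blast
qed

end
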